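(* Let $\mathcal{C}$ be any one of the following eight structures on the Cantor set $2^\omega$: $\mathcal{Q} = (2^\omega, \sqsubseteq)$, $\mathcal{EQ} = (2^\omega, \sqsubseteq, \le_{\mathit{lex}})$, $\mathcal{G} = (2^\omega, \sim)$, $\mathcal{OG} = (2^\omega, \sim, \le_{\mathit{lex}})$, $\mathcal{B} = (2^\omega, \land, \lor, (-)^c, 0, 1)$, $\mathcal{EB} = (2^\omega, \land, \lor, (-)^c, 0, 1, \le_{\mathit{lex}})$, $\mathcal{L} = (2^\omega, \land, \lor)$, $\mathcal{EL} = (2^\omega, \land, \lor, \le_{\mathit{lex}})$. For every finite substructure $\mathcal{A}$ of $\mathcal{C}$ there is a $t \in \mathbb{N}$ such that for every $k \in \mathbb{N}$ and every finite Borel coloring $\gamma : \mathrm{Emb}(\mathcal{A}, \mathcal{C}) \to k$ there is a topological first-order embedding $g : \mathcal{C} \hookrightarrow \mathcal{C}$ such that $|\gamma(g \circ \mathrm{Emb}(\mathcal{A}, \mathcal{C}))| \le t$. In particular, there is a topological copy $\mathcal{K} \subseteq \mathcal{C}$ of $\mathcal{C}$ such that $|\gamma(\mathrm{Emb}(\mathcal{A}, \mathcal{K}))| \le t$.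
   Context: $2^\omega$ carries the product (Cantor) topology; $\mathbb{N}=\{1,2,\dots\}$, $k=\{0,\dots,k-1\}$. Structures: $f \sqsubseteq g$ iff $f(m) \le g(m)$ for all $m \in \omega$. Identifying elements of $2^\omega$ with subsets of $\omega$, $A \le_{\mathit{lex}} B$ iff $A \subseteq B$, or $A, B$ are $\subseteq$-incomparable and $\min(B\setminus A) < \min(A \setminus B)$. $f \sim g$ iff $f \ne g$ and there is $m \in \omega$ with $f(m) = g(m) = 1$. The operations are coordinatewise: $(f \lor g)(m) = \max\{f(m), g(m)\}$, $(f \land g)(m) = \min\{f(m),g(m)\}$, $f^c(m) = 1 - f(m)$; $0$ and $1$ are the constant sequences. A finite substructure $\mathcal{A}$ of $\mathcal{C}$ is a finite subset $A \subseteq 2^\omega$ closed under the operations and constants of $\mathcal{C}$ (if any), with the induced relations/operations. A (first-order) embedding $\phi$ between first-order structures is an injective map that is an isomorphism onto the substructure with underlying set $\mathrm{im}(\phi)$ (in particular $\mathrm{im}(\phi)$ is closed under the fundamental operations). A topological first-order embedding is a map that is both a first-order embedding and a topological embedding (homeomorphism onto its image). $\mathrm{Emb}(\mathcal{A}, \mathcal{C})$ is the set of all first-order embeddings of $\mathcal{A}$ into $\mathcal{C}$, topologized as a subspace of $(2^\omega)^A$; $g \circ \mathrm{Emb}(\mathcal{A},\mathcal{C}) = \{g \circ e : e \in \mathrm{Emb}(\mathcal{A},\mathcal{C})\}$. A topological copy of $\mathcal{C}$ in $\mathcal{C}$ is the image of a topological first-order embedding $\mathcal{C} \hookrightarrow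 \mathcal{C}$, with the induced structure. A finite coloring is Borel if each color class is Borel. *)

theory Defs
  imports "HOL-Analysis.Analysis"
begin

text \<open>
  A first-order structure lists its relations and operations, each paired with its arity;
  they are evaluated on argument lists of that length. A constant is an operation of arity 0.
  Two structures have the same signature iff their lists agree in length and in all arities.
\<close>

record 'a fo_structure =
  carrier :: "'a set"
  rels :: "(nat \<times> ('a list \<Rightarrow> bool)) list"
  ops :: "(nat \<times> ('a list \<Rightarrow> 'a)) list"

definition closed_under_ops :: "'a fo_structure \<Rightarrow> 'a set \<Rightarrow> bool" where
  "closed_under_ops S X \<longleftrightarrow>
     (\<forall>(n, F) \<in> set (ops S). \<forall>xs. length xs = n \<and> set xs \<subseteq> X \<longrightarrow> F xs \<in> X)"

definition is_substructure :: "'a fo_structure \<Rightarrow> 'a set \<Rightarrow> bool" where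
  "is_substructure S X \<longleftrightarrow> X \<subseteq> carrier S \<and> closed_under_ops S X"

definition induced :: "'a fo_structure \<Rightarrow> 'a set \<Rightarrow> 'a fo_structure" where
  "induced S X = S\<lparr>carrier := X\<rparr>"

definition fo_isomorphism :: "'a fo_structure \<Rightarrow> 'b fo_structure \<Rightarrow> ('a \<Rightarrow> 'b) \<Rightarrow> bool" where
  "fo_isomorphism S T \<phi> \<longleftrightarrow>
     bij_betw \<phi> (carrier S) (carrier T) \<and>
     list_all2 (\<lambda>(m, R) (n, R'). m = n \<and>
       (\<forall>xs. length xs = m \<and> set xs \<subseteq> carrier S \<longrightarrow> (R xs \<longleftrightarrow> R' (map \<phi> xs))))
       (rels S) (rels T) \<and>
     list_all2 (\<lambda>(m, F) (n, F'). m = n \<and>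
       (\<forall>xs. length xs = m \<and> set xs \<subseteq> carrier S \<longrightarrow> \<phi> (F xs) = F' (map \<phi> xs)))
       (ops S) (ops T)"

definition fo_embedding :: "'a fo_structure \<Rightarrow> 'b fo_structure \<Rightarrow> ('a \<Rightarrow> 'b) \<Rightarrow> bool" where
  "fo_embedding S T \<phi> \<longleftrightarrow>
     inj_on \<phi> (carrier S) \<and>
     is_substructure T (\<phi> ` carrier S) \<and>
     fo_isomorphism S (induced T (\<phi> ` carrier S)) \<phi>"

text \<open>
  Maps defined on the carrier of \<open>S\<close> only are represented by functions that are
  \<open>undefined\<close> outside it, as in the points of \<open>product_topology\<close>.
\<close>

definition Emb :: "'a fo_structure \<Rightarrow> 'b fo_structure \<Rightarrow> ('a \<Rightarrow> 'b) set" where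
  "Emb S T = {\<phi> \<in> carrier S \<rightarrow>\<^sub>E carrier T. fo_embedding S T \<phi>}"

definition borel_sets_of :: "'a topology \<Rightarrow> 'a set set" where
  "borel_sets_of X = sigma_sets (topspace X) {U. openin X U}"

definition borel_coloring :: "'a topology \<Rightarrow> nat \<Rightarrow> ('a \<Rightarrow> nat) \<Rightarrow> bool" where
  "borel_coloring X k \<gamma> \<longleftrightarrow>
     \<gamma> \<in> topspace X \<rightarrow> {..<k} \<and>
     (\<forall>i<k. {x \<in> topspace X. \<gamma> x = i} \<in> borel_sets_of X)"


type_synonym cantor = "nat \<Rightarrow> bool"

definition cantor_topology :: "cantor topology" where
  "cantor_topology = product_topology (\<lambda>_. discrete_topology UNIV) UNIV"

lemma cantor_topology_eq_euclidean: "cantor_topology = euclidean"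
proof -
  have "discrete_topology (UNIV :: bool set) = euclidean"
    by (simp add: discrete_topology_unique open_discrete)
  then show ?thesis
    by (simp add: cantor_topology_def euclidean_product_topology)
qed

definition supp :: "cantor \<Rightarrow> nat set" where
  "supp f = {m. f m}"

definition sq_le :: "cantor \<Rightarrow> cantor \<Rightarrow> bool" where
  "sq_le f g \<longleftrightarrow> (\<forall>m. f m \<le> g m)"

definition lex_le :: "cantor \<Rightarrow> cantor \<Rightarrow> bool" where
  "lex_le f g \<longleftrightarrow>
     (let A = supp f; B = supp g in
       A \<subseteq> B \<or>
       (\<not> A \<subseteq> B \<and> \<not> B \<subseteq> A \<and> (LEAST m. m \<in> B - A) < (LEAST m. m \<in> A - B)))"

definition adj :: "cantor \<Rightarrow> cantor \<Rightarrow> bool" where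
  "adj f g \<longleftrightarrow> f \<noteq> g \<and> (\<exists>m. f m \<and> g m)"

definition join :: "cantor \<Rightarrow> cantor \<Rightarrow> cantor" where
  "join f g = (\<lambda>m. max (f m) (g m))"

definition meet :: "cantor \<Rightarrow> cantor \<Rightarrow> cantor" where
  "meet f g = (\<lambda>m. min (f m) (g m))"

definition compl :: "cantor \<Rightarrow> cantor" where
  "compl f = (\<lambda>m. \<not> f m)"

definition rel2 :: "('a \<Rightarrow> 'a \<Rightarrow> bool) \<Rightarrow> nat \<times> ('a list \<Rightarrow> bool)" where
  "rel2 R = (2, \<lambda>xs. R (xs ! 0) (xs ! 1))"

definition op0 :: "'a \<Rightarrow> nat \<times> ('a list \<Rightarrow> 'a)" where
  "op0 c = (0, \<lambda>xs. c)"

definition op1 :: "('a \<Rightarrow> 'a) \<Rightarrow> nat \<times> ('a list \<Rightarrow> 'a)" where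
  "op1 F = (1, \<lambda>xs. F (xs ! 0))"

definition op2 :: "('a \<Rightarrow> 'a \<Rightarrow> 'a) \<Rightarrow> nat \<times> ('a list \<Rightarrow> 'a)" where
  "op2 F = (2, \<lambda>xs. F (xs ! 0) (xs ! 1))"

definition struct_Q :: "cantor fo_structure" where
  "struct_Q = \<lparr>carrier = UNIV, rels = [rel2 sq_le], ops = []\<rparr>"

definition struct_EQ :: "cantor fo_structure" where
  "struct_EQ = \<lparr>carrier = UNIV, rels = [rel2 sq_le, rel2 lex_le], ops = []\<rparr>"

definition struct_G :: "cantor fo_structure" where
  "struct_G = \<lparr>carrier = UNIV, rels = [rel2 adj], ops = []\<rparr>"

definition struct_OG :: "cantor fo_structure" where
  "struct_OG = \<lparr>carrier = UNIV, rels = [rel2 adj, rel2 lex_le], ops = []\<rparr>"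

definition struct_B :: "cantor fo_structure" where
  "struct_B = \<lparr>carrier = UNIV, rels = [],
     ops = [op2 meet, op2 join, op1 compl, op0 (\<lambda>_. False), op0 (\<lambda>_. True)]\<rparr>"

definition struct_EB :: "cantor fo_structure" where
  "struct_EB = \<lparr>carrier = UNIV, rels = [rel2 lex_le],
     ops = [op2 meet, op2 join, op1 compl, op0 (\<lambda>_. False), op0 (\<lambda>_. True)]\<rparr>"

definition struct_L :: "cantor fo_structure" where
  "struct_L = \<lparr>carrier = UNIV, rels = [], ops = [op2 meet, op2 join]\<rparr>"

definition struct_EL :: "cantor fo_structure" where
  "struct_EL = \<lparr>carrier = UNIV, rels = [rel2 lex_le], ops = [op2 meet, op2 join]\<rparr>"

definition topological_fo_embedding :: "cantor fo_structure \<Rightarrow> (cantor \<Rightarrow> cantor) \<Rightarrow> bool" where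
  "topological_fo_embedding C g \<longleftrightarrow>
     fo_embedding C C g \<and> embedding_map cantor_topology cantor_topology g"

definition topological_copy :: "cantor fo_structure \<Rightarrow> cantor set \<Rightarrow> bool" where
  "topological_copy C K \<longleftrightarrow> (\<exists>g. topological_fo_embedding C g \<and> K = g ` carrier C)"

definition Emb_topology ::
  "cantor fo_structure \<Rightarrow> cantor fo_structure \<Rightarrow> (cantor \<Rightarrow> cantor) topology" where
  "Emb_topology S T =
     subtopology (product_topology (\<lambda>_. cantor_topology) (carrier S)) (Emb S T)"

lemma topspace_Emb_topology: "topspace (Emb_topology S T) = Emb S T"
  by (auto simp: Emb_topology_def Emb_def cantor_topology_eq_euclidean PiE_def)

end

theory Submission
  imports Defs
begin

text \<open>
  An embedding \<open>e\<close> of a finite structure \<open>A\<close> is a word \<open>m \<mapsto> (a \<mapsto> e a m)\<close> over the finite alphabet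
  \<open>2\<^sup>A\<close>, hence a list of letters (in order of first occurrence) composed with a rigid surjection
  onto an initial segment. A rigid surjection \<open>X\<close> of the natural numbers onto themselves induces
  the topological embedding \<open>f \<mapsto> f \<circ> X\<close> of all eight structures. So it suffices to make the color
  depend on the list only, which is the Carlson--Simpson dual Ramsey theorem for Borel colorings.

  That theorem is proved in two steps. By the Baire property and a fusion, the color of a rigid
  surjection onto \<open>{0, \<dots>, n}\<close> can be made to depend only on the part before the first \<open>n\<close>. Colorings
  that depend on such a prefix only are then treated by induction on \<open>n\<close>, using the Carlson--Simpson
  lemma on variable words, which follows from an idempotent ultrafilter on variable words all of
  whose specializations coincide.
\<close>

section \<open>Idempotents in compact right topological semigroups\<close>

text \<open>Surjectivity of X makes \<open>f \<mapsto> f \<circ> X\<close> injective and respects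
  everything defined coordinatewise; rigidity is what saves the lexicographic order, because it
  keeps the comparison of least elements of preimages. Composing with such a map changes the
  surjection and leaves the list of letters alone. Hence each list contributes at most one color,
  and t is the number of repetition-free lists over \<open>2\<^sup>A\<close>, a quantity depending
  on A only.

  Both steps meet the same difficulty: for every position m, finitely many possible beginnings must
  be settled without spoiling earlier decisions. This is done by maps fixing 0, ..., m and one
  common fusion. They differ in the tail. If no value can appear for the first time after the first
  n, the tails over a fixed beginning are arbitrary sequences over a finite alphabet, where category
  arguments work. If n + 1 is still to come, the color may depend on everything before its first
  occurrence; this is a combinatorial question about finite words, and there variable words are
  used.\<close>

lemma minimal_closedin:
  assumes "compact_space X" and "closedin X S" and "S \<noteq> {}" and "Q S"
    and Q: "\<And>\<C>. \<C> \<noteq> {} \<Longrightarrow> (\<And>K. K \<in> \<C> \<Longrightarrow> Q K) \<Longrightarrow> Q (\<Inter>\<C>)"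
  shows "\<exists>M. M \<subseteq> S \<and> closedin X M \<and> M \<noteq> {} \<and> Q M \<and>
    (\<forall>K. K \<subseteq> M \<longrightarrow> closedin X K \<longrightarrow> K \<noteq> {} \<longrightarrow> Q K \<longrightarrow> K = M)"
proof -
  \<comment> \<open>Zorn's lemma yields maximal sets, hence the passage to complements.\<close>
  define \<A> where "\<A> = uminus ` {K. K \<subseteq> S \<and> closedin X K \<and> K \<noteq> {} \<and> Q K}"
  have "\<A> \<noteq> {}"
    using assms by (auto simp: \<A>_def)
  moreover have "\<Union>\<C> \<in> \<A>" if ne: "\<C> \<noteq> {}" and ch: "subset.chain \<A> \<C>" for \<C>
  proof -
    define \<K> where "\<K> = uminus ` \<C>"
    have K: "K \<subseteq> S \<and> closedin X K \<and> K \<noteq> {} \<and> Q K" if "K \<in> \<K>" for K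
      using that ch unfolding \<K>_def \<A>_def subset_chain_def by auto
    have lin: "K \<subseteq> L \<or> L \<subseteq> K" if "K \<in> \<K>" "L \<in> \<K>" for K L
      using that ch unfolding \<K>_def subset_chain_def by auto
    have ne': "\<K> \<noteq> {}"
      using ne by (auto simp: \<K>_def)
    have fin: "\<F> \<noteq> {} \<Longrightarrow> \<F> \<subseteq> \<K> \<Longrightarrow> \<Inter>\<F> \<in> \<F>" if "finite \<F>" for \<F>
      using that
    proof (induction \<F> rule: finite_induct)
      case (insert K \<F>)
      show ?case
      proof (cases "\<F> = {}")
        case False
        then have "\<Inter>\<F> \<in> \<F>" using insert by auto
        moreover have "K \<subseteq> \<Inter>\<F> \<or> \<Inter>\<F> \<subseteq> K" using lin insert.prems calculation by auto
        ultimately show ?thesis by (auto simp: Int_absorb1 Int_absorb2)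
      qed auto
    qed auto
    \<comment> \<open>The intersection of a finite subchain is one of its members, so compactness
      applies in its finite intersection form.\<close>
    have "\<Inter>\<K> \<noteq> {}"
    proof -
      have "\<Inter>\<F> \<noteq> {}" if "finite \<F>" "\<F> \<subseteq> \<K>" for \<F>
        using fin[OF that(1)] that K by (cases "\<F> = {}") auto
      then show ?thesis
        using assms(1) K unfolding compact_space_fip by metis
    qed
    moreover have "\<Inter>\<K> \<subseteq> S" using K ne' by auto
    moreover have "closedin X (\<Inter>\<K>)" using K ne' by auto
    moreover have "Q (\<Inter>\<K>)" using Q K ne' by auto
    moreover have "\<Union>\<C> = - \<Inter>\<K>" by (auto simp: \<K>_def)
    ultimately show ?thesis by (auto simp: \<A>_def)
  qed
  ultimately obtain N where N: "N \<in> \<A>" "\<forall>L\<in>\<A>. N \<subseteq> L \<longrightarrow> L = N"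
    using subset_Zorn_nonempty[of \<A>] by blast
  then obtain M where M: "N = - M" "M \<subseteq> S" "closedin X M" "M \<noteq> {}" "Q M"
    by (auto simp: \<A>_def)
  have "K = M" if "K \<subseteq> M" "closedin X K" "K \<noteq> {}" "Q K" for K
  proof -
    have "- K \<in> \<A>" using that M by (auto simp: \<A>_def)
    then show ?thesis using N(2) M(1) that(1) by auto
  qed
  with M show ?thesis by blast
qed

locale compact_right_topological_semigroup =
  fixes X :: "'a topology" and f :: "'a \<Rightarrow> 'a \<Rightarrow> 'a"
  assumes compact: "compact_space X" and Hausdorff: "Hausdorff_space X"
    and assoc: "f (f x y) z = f x (f y z)"
    and right_continuous: "continuous_map X X (\<lambda>x. f x y)"
begin

lemma closedin_right_translate: "closedin X S \<Longrightarrow> closedin X ((\<lambda>x. f x y) ` S)"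
  using continuous_imp_closed_map[OF right_continuous compact Hausdorff]
  by (auto simp: closed_map_def)

text \<open>The Ellis-Numakura lemma. In a minimal closed subsemigroup M with e in M, the set M e is
  again one, so it is M and x e = e is solvable in M; the solutions form another one, so e is itself
  a solution.\<close>

lemma idempotent_exists:
  assumes "closedin X S" and "S \<noteq> {}" and "\<And>x y. x \<in> S \<Longrightarrow> y \<in> S \<Longrightarrow> f x y \<in> S"
  shows "\<exists>e\<in>S. f e e = e"
proof -
  obtain M where M: "M \<subseteq> S" "closedin X M" "M \<noteq> {}" "\<forall>x\<in>M. \<forall>y\<in>M. f x y \<in> M"
    and min: "\<And>K. K \<subseteq> M \<Longrightarrow> closedin X K \<Longrightarrow> K \<noteq> {} \<Longrightarrow> \<forall>x\<in>K. \<forall>y\<in>K. f x y \<in> K \<Longrightarrow> K = M"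
    using minimal_closedin[OF compact assms(1,2), of "\<lambda>K. \<forall>x\<in>K. \<forall>y\<in>K. f x y \<in> K"] assms(3)
    by auto
  obtain e where e: "e \<in> M" using M by auto
  have "(\<lambda>x. f x e) ` M = M"
    by (rule min) (use M e in \<open>auto intro: closedin_right_translate simp: assoc[symmetric]\<close>)
  then obtain u where u: "u \<in> M" "f u e = e" using e by (metis imageE)
  have tM: "M \<subseteq> topspace X" using M(2) by (simp add: closedin_subset)
  have "closedin X {x \<in> topspace X. f x e \<in> {e}}"
    by (rule closedin_continuous_map_preimage[OF right_continuous])
       (use e tM in \<open>auto intro!: closedin_Hausdorff_singleton Hausdorff\<close>)
  then have "closedin X (M \<inter> {x \<in> topspace X. f x e \<in> {e}})" using M(2) by blast
  moreover have "M \<inter> {x \<in> topspace X. f x e \<in> {e}} = {x \<in> M. f x e = e}" using tM by auto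
  ultimately have "{x \<in> M. f x e = e} = M"
    by (intro min) (use M u in \<open>auto simp: assoc\<close>)
  then have "f e e = e" using e by blast
  then show ?thesis using e M by blast
qed

text \<open>Any idempotent in a minimal left ideal is minimal for the usual order of idempotents.\<close>

lemma minimal_idempotent_exists:
  assumes "closedin X S" and "S \<noteq> {}" and "\<And>x y. x \<in> S \<Longrightarrow> y \<in> S \<Longrightarrow> f x y \<in> S"
  shows "\<exists>w\<in>S. f w w = w \<and> (\<forall>x\<in>S. f x x = x \<longrightarrow> f x w = x \<longrightarrow> f w x = x \<longrightarrow> x = w)"
proof -
  obtain L where L: "L \<subseteq> S" "closedin X L" "L \<noteq> {}" "\<forall>x\<in>S. \<forall>y\<in>L. f x y \<in> L"
    and min: "\<And>K. K \<subseteq> L \<Longrightarrow> closedin X K \<Longrightarrow> K \<noteq> {} \<Longrightarrow> \<forall>x\<in>S. \<forall>y\<in>K. f x y \<in> K \<Longrightarrow> K = L"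
    using minimal_closedin[OF compact assms(1,2), of "\<lambda>K. \<forall>x\<in>S. \<forall>y\<in>K. f x y \<in> K"] assms(3)
    by auto
  obtain w where w: "w \<in> L" "f w w = w"
    using idempotent_exists[of L] L by (metis subsetD)
  have "x = w" if x: "x \<in> S" "f x x = x" "f x w = x" "f w x = x" for x
  proof -
    have xL: "x \<in> L" using L w x by metis
    \<comment> \<open>S x is a closed left ideal inside L, hence equal to L and containing w. From w
      = s x follows w x = s x x = w, whereas w x = x by assumption.\<close>
    have "(\<lambda>s. f s x) ` S = L"
      by (rule min) (use L xL assms in \<open>auto intro: closedin_right_translate simp: assoc[symmetric]\<close>)
    then obtain s where "w = f s x" using w by (metis imageE)
    then have "f w x = w" using assoc x(2) by metis
    then show ?thesis using x by simp
  qed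
  then show ?thesis using w L by blast
qed

end

section \<open>Ultrafilters on words\<close>

text \<open>Each instance of the two laws involves at most three values of p, which makes them
  closed conditions in the pointwise topology.\<close>

definition ultra :: "('a set \<Rightarrow> bool) \<Rightarrow> bool" where
  "ultra p \<longleftrightarrow> (\<forall>X. p (- X) \<longleftrightarrow> \<not> p X) \<and> (\<forall>X Y. p (X \<inter> Y) \<longleftrightarrow> p X \<and> p Y)"

definition pointwise_topology :: "('a set \<Rightarrow> bool) topology" where
  "pointwise_topology = product_topology (\<lambda>_. discrete_topology UNIV) UNIV"

text \<open>The extension of concatenation to the Stone-Cech compactification of the word monoid: p
  chooses the first factor, q the second.\<close>

definition conv :: "('a list set \<Rightarrow> bool) \<Rightarrow> ('a list set \<Rightarrow> bool) \<Rightarrow> 'a list set \<Rightarrow> bool" where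
  "conv p q X \<longleftrightarrow> p {x. q {y. x @ y \<in> X}}"

definition push :: "('a \<Rightarrow> 'b) \<Rightarrow> ('a set \<Rightarrow> bool) \<Rightarrow> 'b set \<Rightarrow> bool" where
  "push h p X \<longleftrightarrow> p (h -` X)"

lemma ultra_Compl: "ultra p \<Longrightarrow> p (- X) \<longleftrightarrow> \<not> p X"
  by (simp add: ultra_def)

lemma ultra_Int: "ultra p \<Longrightarrow> p (X \<inter> Y) \<longleftrightarrow> p X \<and> p Y"
  by (simp add: ultra_def)

lemma ultra_empty: "ultra p \<Longrightarrow> \<not> p {}"
  using ultra_Int[of p _ "- _"] ultra_Compl[of p] by (metis Compl_disjoint)

lemma ultra_UNIV: "ultra p \<Longrightarrow> p UNIV"
  using ultra_empty ultra_Compl by (metis Compl_UNIV_eq)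

lemma ultra_mono: "ultra p \<Longrightarrow> p X \<Longrightarrow> X \<subseteq> Y \<Longrightarrow> p Y"
  by (metis inf.absorb_iff1 ultra_Int)

lemma ultra_INT:
  assumes "ultra p" and "finite I"
  shows "p (\<Inter>i\<in>I. X i) \<longleftrightarrow> (\<forall>i\<in>I. p (X i))"
  using assms(2) by induction (auto simp: ultra_UNIV ultra_Int assms(1))

lemma ultra_finite_partition:
  assumes "ultra p" and "finite I" and "p (\<Union>i\<in>I. X i)"
  obtains i where "i \<in> I" "p (X i)"
proof -
  have "- (\<Union>i\<in>I. X i) = (\<Inter>i\<in>I. - X i)" by auto
  then show ?thesis
    using that assms ultra_INT[OF assms(1,2), of "\<lambda>i. - X i"] ultra_Compl[OF assms(1)] by metis
qed

lemma ultra_principal: "ultra (\<lambda>X. a \<in> X)"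
  by (auto simp: ultra_def)

lemma ultra_push: "ultra p \<Longrightarrow> ultra (push h p)"
  by (auto simp: ultra_def push_def vimage_Compl)

lemma ultra_conv:
  assumes "ultra p" and "ultra q"
  shows "ultra (conv p q)"
proof -
  have "{x. q {y. x @ y \<in> - X}} = - {x. q {y. x @ y \<in> X}}" for X
    using ultra_Compl[OF assms(2), of "{y. _ @ y \<in> X}"] by (auto simp: Collect_neg_eq)
  moreover have "{x. q {y. x @ y \<in> X \<inter> Y}} = {x. q {y. x @ y \<in> X}} \<inter> {x. q {y. x @ y \<in> Y}}" for X Y
    using ultra_Int[OF assms(2)] by (auto simp: Collect_conj_eq)
  ultimately show ?thesis
    using assms(1) by (simp add: ultra_def conv_def)
qed

lemma push_conv:
  assumes "\<And>x y. h (x @ y) = h x @ h y"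
  shows "push h (conv p q) = conv (push h p) (push h q)"
proof
  fix X
  show "push h (conv p q) X = conv (push h p) (push h q) X"
    unfolding push_def conv_def vimage_def by (simp only: assms mem_Collect_eq)
qed

lemma continuous_map_pointwise_eval:
  "continuous_map pointwise_topology (discrete_topology UNIV) (\<lambda>p. p Y)"
  unfolding pointwise_topology_def by (rule continuous_map_product_projection) simp

lemma compact_pointwise_topology: "compact_space pointwise_topology"
  by (simp add: pointwise_topology_def compact_space_product_topology compact_space_discrete_topology)

lemma Hausdorff_pointwise_topology: "Hausdorff_space pointwise_topology"
  by (simp add: pointwise_topology_def Hausdorff_space_product_topology Hausdorff_space_discrete_topology)

lemma topspace_pointwise_topology [simp]: "topspace pointwise_topology = UNIV"
  by (simp add: pointwise_topology_def)

text \<open>Every coordinate of \<open>conv x y\<close> is a coordinate of x at a set determined by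
  y. So the laws hold for arbitrary predicates, the semigroup is the whole compact product, and
  ultrafilters enter later as a closed subset.\<close>

interpretation conv: compact_right_topological_semigroup pointwise_topology conv
proof
  show "conv (conv x y) z = conv x (conv y z)" for x y z :: "'a list set \<Rightarrow> bool"
    by (simp add: fun_eq_iff conv_def)
  show "continuous_map pointwise_topology pointwise_topology (\<lambda>x. conv x y)"
    for y :: "'a list set \<Rightarrow> bool"
    unfolding pointwise_topology_def continuous_map_componentwise_UNIV conv_def
    using continuous_map_pointwise_eval by (auto simp: pointwise_topology_def)
qed (auto simp: compact_pointwise_topology Hausdorff_pointwise_topology)

lemma closedin_ultra: "closedin pointwise_topology {p. ultra p \<and> p Y}"
proof -
  have 1: "closedin pointwise_topology {p. p X \<longleftrightarrow> b}" for X :: "'a set" and b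
    using closedin_continuous_map_preimage[OF continuous_map_pointwise_eval, of "{b}" X] by simp
  have 2: "closedin pointwise_topology {p. p X \<longleftrightarrow> \<not> p Z}" for X Z :: "'a set"
  proof -
    have "{p. p X \<longleftrightarrow> \<not> p Z} = ({p. p X \<longleftrightarrow> True} \<inter> {p. p Z \<longleftrightarrow> False}) \<union> ({p. p X \<longleftrightarrow> False} \<inter> {p. p Z \<longleftrightarrow> True})"
      by auto
    then show ?thesis by (simp only:) (intro closedin_Un closedin_Int 1)
  qed
  have 3: "closedin pointwise_topology {p. p V \<longleftrightarrow> p X \<and> p Z}" for V X Z :: "'a set"
  proof -
    have "{p. p V \<longleftrightarrow> p X \<and> p Z} = ({p. p V \<longleftrightarrow> True} \<inter> ({p. p X \<longleftrightarrow> True} \<inter> {p. p Z \<longleftrightarrow> True})) \<union>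
        ({p. p V \<longleftrightarrow> False} \<inter> ({p. p X \<longleftrightarrow> False} \<union> {p. p Z \<longleftrightarrow> False}))"
      by auto
    then show ?thesis by (simp only:) (intro closedin_Un closedin_Int 1)
  qed
  have "{p. ultra p \<and> p Y} = (\<Inter>X. {p. p (- X) \<longleftrightarrow> \<not> p X}) \<inter>
      (\<Inter>(X, Z)\<in>UNIV. {p. p (X \<inter> Z) \<longleftrightarrow> p X \<and> p Z}) \<inter> {p. p Y \<longleftrightarrow> True}"
    by (auto simp: ultra_def)
  moreover have "closedin pointwise_topology \<dots>"
    by (intro closedin_Int closedin_INT 1) (use 2 3 in auto)
  ultimately show ?thesis by simp
qed

text \<open>Serves two purposes: specializing the variable to a letter, and renaming it to a fresh
  variable.\<close>

definition subst :: "nat \<Rightarrow> nat \<Rightarrow> nat list \<Rightarrow> nat list" where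
  "subst v c = map (\<lambda>a. if a = v then c else a)"

lemma subst_append [simp]: "subst v c (x @ y) = subst v c x @ subst v c y"
  by (simp add: subst_def)

text \<open>The ultrafilter behind the Hales--Jewett theorem: letters are the numbers below \<open>v\<close>,
  and \<open>v\<close> itself serves as the variable.\<close>

lemma variable_word_ultrafilter:
  fixes v :: nat
  shows "\<exists>p q. ultra p \<and> ultra q \<and> conv p p = p \<and>
    p {x. set x \<subseteq> {..<v}} \<and> q {y. set y \<subseteq> {..v} \<and> v \<in> set y} \<and>
    (\<forall>a<v. push (subst v a) q = p)"
proof -
  define W where "W = {x. set x \<subseteq> {..<v}}"
  define V where "V = {y. set y \<subseteq> {..v} \<and> v \<in> set y}"
  have convI: "conv p q Z" if "ultra p" "ultra q" "p X" "q Y" and Z: "\<And>x y. x \<in> X \<Longrightarrow> y \<in> Y \<Longrightarrow> x @ y \<in> Z"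
    for p q and X Y Z :: "nat list set"
  proof -
    have "q {y. x @ y \<in> Z}" if "x \<in> X" for x
      by (rule ultra_mono[OF \<open>ultra q\<close> \<open>q Y\<close>]) (use Z that in auto)
    then show ?thesis
      unfolding conv_def by (intro ultra_mono[OF \<open>ultra p\<close> \<open>p X\<close>]) auto
  qed
  have VW: "x @ y \<in> V" if "x \<in> V" "y \<in> W" for x y
    using that less_imp_le by (fastforce simp: V_def W_def)
  have WV: "x @ y \<in> V" if "x \<in> W" "y \<in> V" for x y
    using that less_imp_le by (fastforce simp: V_def W_def)
  have VV: "x @ y \<in> V" if "x \<in> V" "y \<in> V" for x y
    using that by (auto simp: V_def)
  have SW: "conv x y \<in> {p. ultra p \<and> p W}" if "x \<in> {p. ultra p \<and> p W}" "y \<in> {p. ultra p \<and> p W}" for x y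
    using that by (auto intro!: ultra_conv convI[of x y W W] simp: W_def)
  have "{p. ultra p \<and> p W} \<noteq> {}"
    using ultra_principal[of "[]"] by (auto simp: W_def)
  then obtain w where w: "ultra w" "w W" "conv w w = w"
    and min: "\<And>x. ultra x \<Longrightarrow> x W \<Longrightarrow> conv x x = x \<Longrightarrow> conv x w = x \<Longrightarrow> conv w x = x \<Longrightarrow> x = w"
    using conv.minimal_idempotent_exists[OF closedin_ultra[of W] _ SW] by auto
  \<comment> \<open>Multiplying by w on the right makes u w = u automatic for every u in S.\<close>
  define S where "S = (\<lambda>x. conv x w) ` {p. ultra p \<and> p V}"
  have SV: "x \<in> {p. ultra p \<and> p V}" if "x \<in> S" for x
    using that w by (auto intro!: ultra_conv convI[of _ w V W] VW simp: S_def)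
  have "\<exists>u\<in>S. conv u u = u"
  proof (rule conv.idempotent_exists)
    show "closedin pointwise_topology S"
      unfolding S_def by (intro conv.closedin_right_translate closedin_ultra)
    show "S \<noteq> {}"
      using ultra_principal[of "[v]"] by (auto simp: S_def V_def)
    show "conv x y \<in> S" if xy: "x \<in> S" "y \<in> S" for x y
    proof -
      obtain y' where y': "y = conv y' w" "ultra y'" "y' V" using xy by (auto simp: S_def)
      have "conv x y' \<in> {p. ultra p \<and> p V}"
        using SV[OF xy(1)] y' by (auto intro!: ultra_conv convI[of x y' V V] VV)
      then show ?thesis unfolding S_def y'(1) conv.assoc[symmetric] by (rule imageI)
    qed
  qed
  then obtain u where u: "u \<in> S" "conv u u = u" by blast
  have uw: "conv u w = u" using u(1) w(3) by (auto simp: S_def conv.assoc)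
  \<comment> \<open>The left factor w adds w q = q to q w = q, which places q below w in the order
    of idempotents.\<close>
  define q where "q = conv w u"
  have q: "ultra q" "q V" "conv q q = q" "conv q w = q" "conv w q = q"
  proof -
    show "ultra q" using SV[OF u(1)] w by (auto simp: q_def ultra_conv)
    show "q V" using SV[OF u(1)] w by (auto intro!: convI[of w u W V] WV simp: q_def)
    show "conv q q = q" "conv q w = q" "conv w q = q"
      unfolding q_def using conv.assoc uw u(2) w(3) by metis+
  qed
  \<comment> \<open>Substitution is a homomorphism that fixes constant words. So it fixes w and
    carries q to an idempotent of constant words below w, which is w by minimality.\<close>
  have "push (subst v a) q = w" if a: "a < v" for a
  proof -
    let ?h = "subst v a"
    have idW: "?h x = x" if "x \<in> W" for x
      using that unfolding subst_def W_def by (intro map_idI) auto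
    have hw: "push ?h w = w"
    proof
      fix X
      have "?h -` X \<inter> W = X \<inter> W" using idW by auto
      then show "push ?h w X = w X" unfolding push_def using ultra_Int[OF w(1)] w(2) by metis
    qed
    show ?thesis
    proof (rule min)
      show "ultra (push ?h q)" using q by (simp add: ultra_push)
      have "V \<subseteq> ?h -` W" using a by (auto simp: V_def W_def subst_def)
      then show "push ?h q W" unfolding push_def using ultra_mono q by blast
      show "conv (push ?h q) (push ?h q) = push ?h q" "conv (push ?h q) w = push ?h q"
        "conv w (push ?h q) = push ?h q"
        using push_conv[of ?h] q hw by (metis subst_append)+
    qed
  qed
  then show ?thesis using w q unfolding W_def V_def by blast
qed

section \<open>Rigid surjections\<close>

text \<open>Equivalently, new values first occur in increasing order. A rigid x codes the partition
  of the naturals into its fibers, numbered by their minima.\<close>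

definition rigid :: "(nat \<Rightarrow> nat) \<Rightarrow> bool" where
  "rigid x \<longleftrightarrow> (\<forall>i. \<forall>j<x i. \<exists>i'<i. x i' = j)"

definition rsurj :: "nat set \<Rightarrow> (nat \<Rightarrow> nat) set" where
  "rsurj V = {x. rigid x \<and> range x = V}"

definition same_until :: "nat \<Rightarrow> (nat \<Rightarrow> nat) \<Rightarrow> (nat \<Rightarrow> nat) \<Rightarrow> bool" where
  "same_until n x x' \<longleftrightarrow> (\<exists>m. x m = n \<and> x' m = n \<and> (\<forall>i<m. x i = x' i \<and> x i < n))"

lemma rsurj_comp:
  assumes "x \<in> rsurj V" and "X \<in> rsurj UNIV"
  shows "x \<circ> X \<in> rsurj V"
proof -
  have "\<exists>i'<i. x (X i') = j" if "j < x (X i)" for i j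
    using assms that unfolding rsurj_def rigid_def by blast
  moreover have "range (x \<circ> X) = V"
    using assms image_comp[of x X UNIV] by (simp add: rsurj_def)
  ultimately show ?thesis by (auto simp: rsurj_def rigid_def)
qed

lemma rigid_first_occurrence:
  assumes "rigid x" and "m \<in> range x"
  shows "\<exists>l. x l = m \<and> (\<forall>i<l. x i < m)"
proof -
  define l where "l = (LEAST i. x i = m)"
  have l: "x l = m" using assms(2) unfolding l_def by (metis (mono_tags, lifting) LeastI imageE)
  have ne: "x i \<noteq> m" if "i < l" for i using that not_less_Least unfolding l_def by blast
  have "x i < m" if i: "i < l" for i
  proof (rule ccontr)
    assume "\<not> x i < m"
    then have "m < x i" using ne i by force
    then obtain i' where "i' < i" "x i' = m" using assms(1) unfolding rigid_def by blast
    then show False using ne[of i'] i by simp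
  qed
  then show ?thesis using l by blast
qed

text \<open>If m is the first place of n in x, the first place of n in \<open>x \<circ> X\<close> is
  that of m in X, and before it X stays below m.\<close>

lemma same_until_comp:
  assumes "X \<in> rsurj UNIV" and "same_until n x x'"
  shows "same_until n (x \<circ> X) (x' \<circ> X)"
proof -
  obtain m where m: "x m = n" "x' m = n" "\<forall>i<m. x i = x' i \<and> x i < n"
    using assms(2) by (auto simp: same_until_def)
  obtain l where "X l = m" "\<And>i. i < l \<Longrightarrow> X i < m"
    using rigid_first_occurrence[of X m] assms(1) unfolding rsurj_def by auto
  then show ?thesis unfolding same_until_def using m by (intro exI[of _ l]) (metis comp_apply)
qed

lemma same_until_sym: "same_until n x x' \<Longrightarrow> same_until n x' x"
  unfolding same_until_def by metis

section \<open>The Carlson--Simpson lemma\<close>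

text \<open>Concatenates a constant word and infinitely many variable words with fresh variables
  \<open>v, v + 1, \<dots>\<close> into a rigid surjection.\<close>

lemma assemble_words:
  fixes v :: nat and x :: "nat list" and y :: "nat \<Rightarrow> nat list"
  defines "pre \<equiv> \<lambda>j. ([0..<v] @ x) @ concat (map (\<lambda>i. subst v (v + i) (y i)) [0..<j])"
  assumes x: "set x \<subseteq> {..<v}" and y: "\<And>i. set (y i) \<subseteq> {..v}" "\<And>i. v \<in> set (y i)"
  shows "\<exists>Z\<in>rsurj UNIV. (\<forall>i<v. Z i = i) \<and> (\<forall>j. map Z [0..<length (pre j)] = pre j)"
proof -
  have preS: "pre (Suc j) = pre j @ subst v (v + j) (y j)" for j by (simp add: pre_def)
  have y_ne: "y j \<noteq> []" for j using y(2)[of j] by auto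
  have len: "j \<le> length (pre j)" for j
  proof (induction j)
    case (Suc j)
    then show ?case using y_ne[of j] by (cases "y j") (auto simp: preS subst_def)
  qed simp
  have nth: "i < length (pre j) \<Longrightarrow> i < length (pre j') \<and> pre j' ! i = pre j ! i" if "j \<le> j'" for i j j'
    using that by (induction j' rule: dec_induct) (auto simp: preS nth_append)
  have set_pre: "set (pre j) = {..<v + j}" for j
  proof (induction j)
    case 0
    then show ?case using x by (auto simp: pre_def)
  next
    case (Suc j)
    then show ?case using y(1)[of j] y(2)[of j] by (fastforce simp: preS subst_def)
  qed
  have rig: "\<exists>i'<i. pre j ! i' = l" if "i < length (pre j)" "l < pre j ! i" for i j l
    using that
  proof (induction j)
    case 0
    have e: "pre 0 = [0..<v] @ x" by (simp add: pre_def)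
    show ?case
    proof (cases "i < v")
      case True
      then show ?thesis using 0 by (intro exI[of _ l]) (auto simp: e nth_append)
    next
      case False
      have "pre 0 ! i < v" using set_pre[of 0] 0(1) nth_mem by fastforce
      then show ?thesis using 0 False by (intro exI[of _ l]) (auto simp: e nth_append)
    qed
  next
    case (Suc j)
    show ?case
    proof (cases "i < length (pre j)")
      case True
      then have "l < pre j ! i" using Suc.prems by (simp add: preS nth_append)
      then obtain i' where "i' < i" "pre j ! i' = l" using Suc.IH True by blast
      then show ?thesis using True by (intro exI[of _ i']) (simp add: preS nth_append)
    next
      case False
      \<comment> \<open>The new block has no symbol above v + j, so every smaller l is below v + j
        and already occurs in \<open>pre j\<close>.\<close>
      have "pre (Suc j) ! i < v + Suc j" using set_pre[of "Suc j"] Suc.prems(1) nth_mem by blast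
      then have "l \<in> set (pre j)" using set_pre[of j] Suc.prems(2) by auto
      then obtain i' where "i' < length (pre j)" "pre j ! i' = l" by (metis in_set_conv_nth)
      then show ?thesis using False by (intro exI[of _ i']) (auto simp: preS nth_append)
    qed
  qed
  \<comment> \<open>\<open>pre (Suc i)\<close> is longer than i, so this entry exists and is never
    changed later.\<close>
  define Z where "Z i = pre (Suc i) ! i" for i
  have Z: "Z i = pre j ! i" if "i < length (pre j)" for i j
  proof (cases "j \<le> Suc i")
    case True
    then show ?thesis using nth that by (auto simp: Z_def)
  next
    case False
    then show ?thesis using nth[of "Suc i" j i] len[of "Suc i"] by (auto simp: Z_def)
  qed
  have li: "i < length (pre (Suc i))" for i using len[of "Suc i"] by simp
  have "\<exists>i'<i. Z i' = l" if "l < Z i" for i l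
  proof -
    obtain i' where "i' < i" "pre (Suc i) ! i' = l" using rig[OF li] \<open>l < Z i\<close> Z_def by metis
    then show ?thesis using Z[of i' "Suc i"] li[of i] by auto
  qed
  moreover have "l \<in> range Z" for l
  proof -
    have "l \<in> set (pre (Suc l))" using set_pre by auto
    then show ?thesis using Z by (metis in_set_conv_nth rangeI)
  qed
  ultimately have "Z \<in> rsurj UNIV" unfolding rsurj_def rigid_def by auto
  moreover have "Z i = i" if "i < v" for i
    using Z[of i 0] that by (simp add: pre_def nth_append)
  moreover have "map Z [0..<length (pre j)] = pre j" for j
    by (rule nth_equalityI) (auto simp: Z)
  ultimately show ?thesis by blast
qed

text \<open>The color of \<open>z \<circ> Z\<close> sees the last relevant variable word only up to its first variable;
  hence the color class is chosen large for \<open>p\<close> followed by the truncations \<open>tr\<close> under \<open>q\<close>.\<close>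

lemma carlson_simpson:
  fixes d :: "(nat \<Rightarrow> nat) \<Rightarrow> nat" and v k :: nat
  assumes inv: "\<And>x x'. x \<in> rsurj {..<Suc v} \<Longrightarrow> x' \<in> rsurj {..<Suc v} \<Longrightarrow> same_until v x x' \<Longrightarrow> d x = d x'"
    and bounded: "\<And>x. d x < k"
  shows "\<exists>Z\<in>rsurj UNIV. (\<forall>i<v. Z i = i) \<and>
    (\<exists>c. \<forall>z\<in>rsurj {..<Suc v}. (\<forall>i<v. z i = i) \<longrightarrow> d (z \<circ> Z) = c)"
proof -
  \<comment> \<open>The padding v turns a finite word over the letters into a surjection onto {0,
    ..., v}; by \<open>inv\<close> its color is that of every surjection with the same part before
    the first v.\<close>
  define word where "word x = (\<lambda>i. if i < length ([0..<v] @ x) then ([0..<v] @ x) ! i else v)" for x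
  obtain p q where pq: "ultra p" "ultra q" "conv p p = p"
      and pW: "p {x. set x \<subseteq> {..<v}}" and qV: "q {y. set y \<subseteq> {..v} \<and> v \<in> set y}"
      and push: "\<And>a. a < v \<Longrightarrow> push (subst v a) q = p"
    using variable_word_ultrafilter[of v] by blast
  define tr where "tr = takeWhile (\<lambda>a. a \<noteq> v)"
  have "ultra (conv p (push tr q))" using pq by (simp add: ultra_conv ultra_push)
  moreover have "(\<Union>c\<in>{..<k}. {x. d (word x) = c}) = UNIV" using bounded by auto
  ultimately obtain c where c: "conv p (push tr q) {x. d (word x) = c}"
    using ultra_finite_partition[of "conv p (push tr q)" "{..<k}" "\<lambda>c. {x. d (word x) = c}"] ultra_UNIV
    by (metis finite_lessThan)
  define Y where "Y = {x. q {y. d (word (x @ tr y)) = c}}"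
  have pY: "p Y" using c by (simp add: conv_def push_def vimage_def Y_def)
  \<comment> \<open>The starred set of an idempotent: from a word in \<open>Ys\<close>, p-almost
    every continuation leads to \<open>Ys\<close> again (fact \<open>step\<close>), so the
    construction never gets stuck.\<close>
  define Ys where "Ys = {x. set x \<subseteq> {..<v}} \<inter> (Y \<inter> {x. p {z. x @ z \<in> Y}})"
  have pYs: "p Ys"
  proof -
    have "p {x. p {z. x @ z \<in> Y}}" using pY pq(3) conv_def[of p p Y] by simp
    then show ?thesis using pY pW by (simp add: Ys_def ultra_Int pq(1))
  qed
  have step: "p {z. x @ z \<in> Ys}" if x: "x \<in> Ys" for x
  proof -
    have "p {z. x @ z \<in> Y}" using x by (simp add: Ys_def)
    then have "p {z. p {z'. x @ z @ z' \<in> Y}}" using pq(3) conv_def[of p p "{z. x @ z \<in> Y}"] by simp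
    then have "p ({z. set z \<subseteq> {..<v}} \<inter> ({z. x @ z \<in> Y} \<inter> {z. p {z'. x @ z @ z' \<in> Y}}))"
      using pW \<open>p {z. x @ z \<in> Y}\<close> by (simp add: ultra_Int pq)
    then show ?thesis
      by (rule ultra_mono[OF pq(1)]) (use x in \<open>auto simp: Ys_def\<close>)
  qed
  \<comment> \<open>Variable words y that can follow x: stopping at the variable gives color c, and
    every specialization remains in \<open>Ys\<close>. They are q-large since each specialization
    maps q to p.\<close>
  define G where "G x = {y. d (word (x @ tr y)) = c} \<inter> (\<Inter>a\<in>{..<v}. {y. x @ subst v a y \<in> Ys})" for x
  have qG: "q (G x)" if x: "x \<in> Ys" for x
  proof -
    have "q {y. x @ subst v a y \<in> Ys}" if "a < v" for a
    proof -
      have "push (subst v a) q {z. x @ z \<in> Ys}" using step[OF x] push[OF that] by simp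
      then show ?thesis by (simp add: push_def vimage_def)
    qed
    moreover have "q {y. d (word (x @ tr y)) = c}" using x by (simp add: Ys_def Y_def)
    ultimately show ?thesis by (simp add: G_def ultra_Int ultra_INT pq)
  qed
  have "\<exists>y. set y \<subseteq> {..v} \<and> v \<in> set y \<and> (\<forall>x\<in>F. y \<in> G x)" if "finite F" "F \<subseteq> Ys" for F
  proof -
    have "q ({y. set y \<subseteq> {..v} \<and> v \<in> set y} \<inter> (\<Inter>x\<in>F. G x))"
      using that qG qV by (auto simp: ultra_Int ultra_INT pq)
    then have "{y. set y \<subseteq> {..v} \<and> v \<in> set y} \<inter> (\<Inter>x\<in>F. G x) \<noteq> {}"
      using ultra_empty[OF pq(2)] by metis
    then show ?thesis by auto
  qed
  then obtain ch where ch: "\<And>F. finite F \<Longrightarrow> F \<subseteq> Ys \<Longrightarrow>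
      set (ch F) \<subseteq> {..v} \<and> v \<in> set (ch F) \<and> (\<forall>x\<in>F. ch F \<in> G x)"
    by metis
  have "Ys \<noteq> {}" using pYs ultra_empty[OF pq(1)] by auto
  then obtain x0 where x0: "x0 \<in> Ys" by auto
  \<comment> \<open>All words obtained from x0 and the first j variable words by substituting
    letters independently. They are finitely many, so a single next variable word is good for all of
    them.\<close>
  define F where "F = rec_nat {x0} (\<lambda>_ F. (\<lambda>(x, a). x @ subst v a (ch F)) ` (F \<times> {..<v}))"
  define y where "y j = ch (F j)" for j
  have F0: "F 0 = {x0}" by (simp add: F_def)
  have FS: "F (Suc j) = (\<lambda>(x, a). x @ subst v a (y j)) ` (F j \<times> {..<v})" for j
    by (simp add: F_def y_def)
  have F: "finite (F j) \<and> F j \<subseteq> Ys" for j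
  proof (induction j)
    case (Suc j)
    then have "\<forall>x\<in>F j. y j \<in> G x" using ch by (simp add: y_def)
    then have "x @ subst v a (y j) \<in> Ys" if "x \<in> F j" "a < v" for x a
      using that unfolding G_def by blast
    then show ?case using Suc by (auto simp: FS)
  qed (simp add: F0 x0)
  have y: "set (y j) \<subseteq> {..v}" "v \<in> set (y j)" "\<And>x. x \<in> F j \<Longrightarrow> y j \<in> G x" for j
    using ch F by (auto simp: y_def)
  define pre where "pre j = ([0..<v] @ x0) @ concat (map (\<lambda>i. subst v (v + i) (y i)) [0..<j])" for j
  have preS: "pre (Suc j) = pre j @ subst v (v + j) (y j)" for j by (simp add: pre_def)
  have x0v: "set x0 \<subseteq> {..<v}" using x0 by (simp add: Ys_def)
  obtain Z where Z: "Z \<in> rsurj UNIV" "\<And>i. i < v \<Longrightarrow> Z i = i" "\<And>j. map Z [0..<length (pre j)] = pre j"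
    using assemble_words[of x0 v y, folded pre_def] x0v y(1,2) by blast
  have "d (z \<circ> Z) = c" if z: "z \<in> rsurj {..<Suc v}" "\<forall>i<v. z i = i" for z
  proof -
    have "v \<in> range z" using z(1) by (auto simp: rsurj_def)
    then obtain l where l: "z l = v" "\<And>i. i < l \<Longrightarrow> z i < v"
      using rigid_first_occurrence[of z v] z(1) unfolding rsurj_def by blast
    have "v \<le> l" using z(2) l(1) by (metis less_irrefl linorder_not_le)
    \<comment> \<open>The index of the block whose variable z sends to v; the variables of all
      earlier blocks are sent to letters.\<close>
    define j where "j = l - v"
    have lj: "l = v + j" using \<open>v \<le> l\<close> by (simp add: j_def)
    have sub: "map z (subst v (v + i) (y i)) = subst v (z (v + i)) (y i)" for i
      using y(1)[of i] z(2) by (auto simp: subst_def subset_iff order_le_less)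
    have "\<exists>x\<in>F j'. map z (pre j') = [0..<v] @ x" if "j' \<le> j" for j'
      using that
    proof (induction j')
      case 0
      have "map z ([0..<v] @ x0) = [0..<v] @ x0"
        by (rule map_idI) (use z(2) x0v in auto)
      then show ?case by (simp add: F0 pre_def)
    next
      case (Suc j')
      then obtain x where x: "x \<in> F j'" "map z (pre j') = [0..<v] @ x" by auto
      have "z (v + j') < v" using l(2) lj Suc.prems by simp
      then have "x @ subst v (z (v + j')) (y j') \<in> F (Suc j')" using x(1) by (auto simp: FS)
      then show ?case using x(2) sub by (auto simp: preS)
    qed
    then obtain x where x: "x \<in> F j" "map z (pre j) = [0..<v] @ x" by auto
    \<comment> \<open>The part of \<open>z \<circ> Z\<close> before its first v: the specialized
      earlier blocks followed by the truncation of block j.\<close>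
    define N where "N = [0..<v] @ (x @ tr (y j))"
    obtain s r where sr: "y j = s @ v # r" "v \<notin> set s" using split_list_first[OF y(2)[of j]] by blast
    then have "tr (y j) = s" unfolding tr_def by (subst sr(1), subst takeWhile_append2) auto
    with sr have r: "y j = tr (y j) @ v # r" by simp
    have str: "subst v b (tr w) = tr w" for b w
      unfolding subst_def tr_def by (rule map_idI) (auto dest: set_takeWhileD)
    have M: "map z (pre (Suc j)) = N @ v # subst v v r"
    proof -
      have "subst v v (y j) = subst v v (tr (y j) @ [v] @ r)" using r by simp
      also have "\<dots> = tr (y j) @ v # subst v v r" unfolding subst_append str by (simp add: subst_def)
      finally show ?thesis using x(2) sub[of j] l(1) lj by (simp add: preS N_def)
    qed
    have nthM: "z (Z i) = (N @ v # subst v v r) ! i" if "i \<le> length N" for i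
    proof -
      have "length (pre (Suc j)) > length N" using arg_cong[OF M, of length] by simp
      then have "i < length (pre (Suc j))" using that by simp
      moreover have "map (z \<circ> Z) [0..<length (pre (Suc j))] = N @ v # subst v v r"
        using M Z(3)[of "Suc j"] by (metis map_map)
      ultimately show ?thesis by (metis add_0 comp_apply length_map length_upt nth_map_upt minus_nat.diff_0)
    qed
    have xv: "set x \<subseteq> {..<v}" using F[of j] x(1) by (auto simp: Ys_def)
    have trv: "set (tr (y j)) \<subseteq> {..<v}"
      using y(1)[of j] unfolding tr_def by (fastforce dest: set_takeWhileD)
    have Nv: "set N \<subseteq> {..<v}" using xv trv by (auto simp: N_def)
    have word: "word (x @ tr (y j)) = (\<lambda>i. if i < length N then N ! i else v)"
      unfolding word_def N_def ..
    have lenN: "v \<le> length N" by (simp add: N_def)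
    have Ni: "N ! i = i" if "i < v" for i using that by (simp add: N_def nth_append)
    have Nlt: "N ! i < v" if "i < length N" for i using that Nv nth_mem by fastforce
    have w: "word (x @ tr (y j)) \<in> rsurj {..<Suc v}"
    proof -
      let ?w = "word (x @ tr (y j))"
      have wi: "?w i = i" if "i < v" for i
        using that lenN Ni by (auto simp: word)
      have le: "?w i \<le> v" for i using Nlt by (auto simp: word less_imp_le)
      have "rigid ?w"
        unfolding rigid_def
      proof (intro allI impI)
        fix i a assume a: "a < ?w i"
        have "a < v" using a le[of i] by simp
        moreover have "a < i" using a wi[of i] calculation by (cases "i < v") auto
        ultimately show "\<exists>i'<i. ?w i' = a" using wi[of a] by auto
      qed
      moreover have "a \<in> range ?w" if "a < Suc v" for a
      proof (cases "a < v")
        case True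
        then show ?thesis using wi by (metis rangeI)
      next
        case False
        then have "?w (length N) = a" using that by (simp add: word)
        then show ?thesis by blast
      qed
      ultimately show ?thesis unfolding rsurj_def using le by (auto simp: less_Suc_eq_le)
    qed
    have "same_until v (z \<circ> Z) (word (x @ tr (y j)))"
      unfolding same_until_def
      by (intro exI[of _ "length N"]) (auto simp: nthM word nth_append Nlt)
    then have "d (z \<circ> Z) = d (word (x @ tr (y j)))"
      using inv rsurj_comp[OF z(1) Z(1)] w by blast
    then show ?thesis using y(3)[OF x(1)] by (simp add: G_def)
  qed
  then show ?thesis using Z(2) by (intro bexI[OF _ Z(1)] conjI exI[of _ c]) auto
qed

section \<open>Borel colorings\<close>

text \<open>Relative density in T is expressed through open sets of the ambient space, which avoids
  subspace topologies.\<close>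

definition dense_open :: "'a::topological_space set \<Rightarrow> 'a set \<Rightarrow> bool" where
  "dense_open T D \<longleftrightarrow> open D \<and> (\<forall>V. open V \<longrightarrow> V \<inter> T \<noteq> {} \<longrightarrow> V \<inter> T \<inter> D \<noteq> {})"

text \<open>The Baire property relative to T, by induction on the generation of Borel sets; the
  points of T missed by some member of \<open>\<D>\<close> form the exceptional meager set.\<close>

lemma borel_eq_open_on_dense_open:
  fixes T X :: "'a::topological_space set"
  assumes "X \<in> sets borel"
  shows "\<exists>\<D> U. countable \<D> \<and> (\<forall>D\<in>\<D>. dense_open T D) \<and> open U \<and>
    (\<forall>x\<in>T. (\<forall>D\<in>\<D>. x \<in> D) \<longrightarrow> (x \<in> X \<longleftrightarrow> x \<in> U))"
proof -
  have "X \<in> sigma_sets UNIV {S. open S}"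
    using assms by (simp add: borel_def)
  then show ?thesis
  proof induction
    case (Basic X)
    then show ?case by (intro exI[of _ "{}"] exI[of _ X]) auto
  next
    case Empty
    then show ?case by (intro exI[of _ "{}"]) auto
  next
    case (Compl X)
    then obtain \<D> U where D: "countable \<D>" "\<forall>D\<in>\<D>. dense_open T D" "open U"
      "\<forall>x\<in>T. (\<forall>D\<in>\<D>. x \<in> D) \<longrightarrow> (x \<in> X \<longleftrightarrow> x \<in> U)" by auto
    \<comment> \<open>The exterior of U relative to T. It represents the complement once the
      boundary is discarded by adding the dense set U \<union> W to the family.\<close>
    define W where "W = interior (- (U \<inter> T))"
    have W: "x \<notin> U" if "x \<in> W" "x \<in> T" for x
      using that interior_subset[of "- (U \<inter> T)"] by (auto simp: W_def)
    have "V \<inter> T \<inter> (U \<union> W) \<noteq> {}" if V: "open V" "V \<inter> T \<noteq> {}" for V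
    proof (cases "V \<inter> T \<inter> U = {}")
      case True
      then have "V \<subseteq> W" unfolding W_def using V(1) by (intro interior_maximal) auto
      then show ?thesis using V(2) by blast
    qed auto
    then have "dense_open T (U \<union> W)" using D(3) by (auto simp: dense_open_def W_def)
    then show ?case
      using D W by (intro exI[of _ "insert (U \<union> W) \<D>"] exI[of _ W]) (auto simp: W_def)
  next
    case (Union X)
    then obtain \<D> U where D: "\<And>i. countable (\<D> i)" "\<And>i. \<forall>D\<in>\<D> i. dense_open T D" "\<And>i. open (U i)"
      "\<And>i. \<forall>x\<in>T. (\<forall>D\<in>\<D> i. x \<in> D) \<longrightarrow> (x \<in> X i \<longleftrightarrow> x \<in> U i)" by metis
    show ?case
    proof (intro exI[of _ "\<Union>i. \<D> i"] exI[of _ "\<Union>i. U i"] conjI ballI impI)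
      fix x assume x: "x \<in> T" "\<forall>D\<in>\<Union> (range \<D>). x \<in> D"
      then have "x \<in> X i \<longleftrightarrow> x \<in> U i" for i using D(4)[of i] by blast
      then show "x \<in> \<Union> (range X) \<longleftrightarrow> x \<in> \<Union> (range U)" by auto
    qed (use D in auto)
  qed
qed

lemma open_contains_cylinder:
  fixes U :: "(nat \<Rightarrow> nat) set"
  assumes "open U" and "x \<in> U"
  shows "\<exists>n. \<forall>y. (\<forall>i<n. y i = x i) \<longrightarrow> y \<in> U"
proof -
  have "openin (product_topology (\<lambda>_. euclidean) UNIV) U"
    using assms(1) by (simp add: euclidean_product_topology)
  from product_topology_open_contains_basis[OF this assms(2)]
  obtain V where V: "x \<in> (\<Pi>\<^sub>E i\<in>UNIV. V i)" "finite {i. V i \<noteq> UNIV}" "(\<Pi>\<^sub>E i\<in>UNIV. V i) \<subseteq> U"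
    by (auto simp: topspace_euclidean)
  obtain n where n: "\<forall>i\<in>{i. V i \<noteq> UNIV}. i < n"
    using V(2) finite_nat_set_iff_bounded by blast
  have "y \<in> U" if "\<forall>i<n. y i = x i" for y
  proof -
    have "y i \<in> V i" for i
      using that n V(1) by (cases "V i = UNIV") (auto simp: PiE_iff)
    then show ?thesis using V(3) by (auto simp: PiE_iff subset_iff)
  qed
  then show ?thesis by blast
qed

lemma open_cylinder: "open {x :: nat \<Rightarrow> nat. \<forall>i<n. x i = u i}"
proof -
  have "open ((\<lambda>x :: nat \<Rightarrow> nat. x i) -` {u i})" for i
    by (rule open_vimage) (auto simp: open_discrete)
  then have "open (\<Inter>i\<in>{..<n}. (\<lambda>x :: nat \<Rightarrow> nat. x i) -` {u i})"
    by (intro open_INT) auto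
  moreover have "(\<Inter>i\<in>{..<n}. (\<lambda>x :: nat \<Rightarrow> nat. x i) -` {u i}) = {x. \<forall>i<n. x i = u i}" by auto
  ultimately show ?thesis by simp
qed

text \<open>The prefixes are treated one at a time: density finds a point of D beyond the current
  word, openness keeps a finite piece of it. Lengthening t does not harm the prefixes already
  treated.\<close>

lemma generic_extension:
  fixes v :: nat
  defines "T \<equiv> {x :: nat \<Rightarrow> nat. (\<forall>i<v. x i = i) \<and> (\<forall>i. x i < v)}"
  assumes v: "0 < v" and D: "dense_open T D" and "finite F"
    and "\<And>p. p \<in> F \<Longrightarrow> set p \<subseteq> {..<v} \<and> (\<exists>x. p = [0..<v] @ x)"
  shows "\<exists>t. set t \<subseteq> {..<v} \<and> (\<forall>p\<in>F. \<forall>z\<in>T. (\<forall>i<length (p @ t). z i = (p @ t) ! i) \<longrightarrow> z \<in> D)"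
  using assms(4,5)
proof (induction F)
  case empty
  then show ?case by (intro exI[of _ "[]"]) auto
next
  case (insert p F)
  then obtain t where t: "set t \<subseteq> {..<v}"
    "\<forall>p\<in>F. \<forall>z\<in>T. (\<forall>i<length (p @ t). z i = (p @ t) ! i) \<longrightarrow> z \<in> D"
    by auto
  define q where "q = p @ t"
  obtain x where x: "p = [0..<v] @ x" and p: "set p \<subseteq> {..<v}" using insert.prems by blast
  have qv: "set q \<subseteq> {..<v}" using t(1) p by (auto simp: q_def)
  \<comment> \<open>Padding with the letter 0, available as 0 < v, shows that the cylinder of q
    meets T.\<close>
  define z0 where "z0 i = (if i < length q then q ! i else 0)" for i
  have "z0 i < v" for i using qv v nth_mem by (fastforce simp: z0_def)
  moreover have "z0 i = i" if "i < v" for i using that by (auto simp: z0_def q_def x nth_append)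
  ultimately have "z0 \<in> T" by (auto simp: T_def)
  moreover have "z0 \<in> {z. \<forall>i<length q. z i = q ! i}" by (simp add: z0_def)
  ultimately have "{z. \<forall>i<length q. z i = q ! i} \<inter> T \<noteq> {}" by blast
  then have "{z. \<forall>i<length q. z i = q ! i} \<inter> T \<inter> D \<noteq> {}"
    using D open_cylinder[of "length q" "\<lambda>i. q ! i"] unfolding dense_open_def by blast
  then obtain z where z: "\<forall>i<length q. z i = q ! i" "z \<in> T" "z \<in> D" by auto
  obtain n where n: "\<forall>y. (\<forall>i<n. y i = z i) \<longrightarrow> y \<in> D"
    using open_contains_cylinder[OF _ z(3)] D unfolding dense_open_def by blast
  \<comment> \<open>Taking n further letters of z guarantees that q followed by t' covers the first
    n coordinates.\<close>
  define t' where "t' = map z [length q..<length q + n]"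
  have "y \<in> D" if y: "\<forall>i<length (q @ t'). y i = (q @ t') ! i" for y
  proof -
    have "y i = z i" if "i < n" for i
      using y that z(1) by (cases "i < length q") (auto simp: t'_def nth_append)
    then show ?thesis using n by blast
  qed
  moreover have "set (t @ t') \<subseteq> {..<v}" using t(1) z(2) by (auto simp: t'_def T_def)
  moreover have "z \<in> D" if "r \<in> F" "z \<in> T" "\<forall>i<length (r @ t @ t'). z i = (r @ t @ t') ! i" for r z
  proof -
    have "z i = (r @ t) ! i" if i: "i < length (r @ t)" for i
    proof -
      have "z i = ((r @ t) @ t') ! i" using i \<open>\<forall>i<length (r @ t @ t'). z i = (r @ t @ t') ! i\<close> by simp
      then show ?thesis using i by (simp only: nth_append if_True)
    qed
    then show ?thesis using t(2) that by blast
  qed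
  ultimately show ?case by (intro exI[of _ "t @ t'"]) (auto simp: q_def)
qed

text \<open>Whatever z is, it maps the first \<open>len j\<close> values of Z to one of finitely
  many words over the letters. Block j starts with an extension that forces all of these into
  \<open>D j\<close>, and ends with a fresh variable so that Z is onto.\<close>

lemma generic_rsurj:
  fixes v :: nat
  defines "T \<equiv> {x :: nat \<Rightarrow> nat. (\<forall>i<v. x i = i) \<and> (\<forall>i. x i < v)}"
  assumes v: "0 < v" and D: "\<And>j::nat. dense_open T (D j)" and x: "set x \<subseteq> {..<v}"
  shows "\<exists>Z\<in>rsurj UNIV. (\<forall>i<v. Z i = i) \<and> (\<forall>i<length x. Z (v + i) = x ! i) \<and>
    (\<forall>z\<in>rsurj {..<v}. (\<forall>i<v. z i = i) \<longrightarrow> (\<forall>j. z \<circ> Z \<in> D j))"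
proof -
  define F where "F L = {p. set p \<subseteq> {..<v} \<and> length p = L} \<inter> range (\<lambda>x. [0..<v] @ x)" for L
  have "\<exists>t. set t \<subseteq> {..<v} \<and> (\<forall>p\<in>F L. \<forall>z\<in>T. (\<forall>i<length (p @ t). z i = (p @ t) ! i) \<longrightarrow> z \<in> D j)" for L j
    unfolding T_def
    by (rule generic_extension[OF v D[unfolded T_def]])
       (auto simp: F_def intro: finite_Int finite_lists_length_eq)
  then obtain t where t: "\<And>L j. set (t L j) \<subseteq> {..<v}"
    "\<And>L j. \<forall>p\<in>F L. \<forall>z\<in>T. (\<forall>i<length (p @ t L j). z i = (p @ t L j) ! i) \<longrightarrow> z \<in> D j"
    by metis
  \<comment> \<open>The lengths are computable beforehand, since t depends only on the length of the
    prefix. The summand 1 is the variable closing the block.\<close>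
  define len where "len = rec_nat (v + length x) (\<lambda>j L. L + length (t L j) + 1)"
  define y where "y j = t (len j) j @ [v]" for j
  define pre where "pre j = ([0..<v] @ x) @ concat (map (\<lambda>i. subst v (v + i) (y i)) [0..<j])" for j
  have preS: "pre (Suc j) = pre j @ subst v (v + j) (y j)" for j by (simp add: pre_def)
  have len: "length (pre j) = len j" for j
    by (induction j) (simp_all add: preS len_def y_def subst_def pre_def)
  have y: "set (y j) \<subseteq> {..v}" "v \<in> set (y j)" for j
    using t(1)[of "len j" j] by (auto simp: y_def)
  obtain Z where Z: "Z \<in> rsurj UNIV" "\<forall>i<v. Z i = i" "\<And>j. map Z [0..<length (pre j)] = pre j"
    using assemble_words[of x v y, folded pre_def] x y by blast
  have nthZ: "Z i = pre j ! i" if "i < length (pre j)" for i j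
    using arg_cong[OF Z(3)[of j], of "\<lambda>l. l ! i"] that by simp
  have "z \<circ> Z \<in> D j" if z: "z \<in> rsurj {..<v}" "\<forall>i<v. z i = i" for z j
  proof -
    have zv: "z i < v" for i using z(1) by (auto simp: rsurj_def)
    define p where "p = map z (pre j)"
    have "map z ([0..<v] @ x) = [0..<v] @ x" by (rule map_idI) (use z(2) x in auto)
    then have "p = [0..<v] @ (x @ map z (concat (map (\<lambda>i. subst v (v + i) (y i)) [0..<j])))"
      by (simp add: p_def pre_def)
    then have "p \<in> range (\<lambda>x. [0..<v] @ x)" by blast
    moreover have "set p \<subseteq> {..<v}" "length p = len j" using zv len by (auto simp: p_def)
    ultimately have pF: "p \<in> F (len j)" by (simp add: F_def)
    have zZ: "z \<circ> Z \<in> T" using zv z(2) Z(2) by (auto simp: T_def)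
    let ?t = "t (len j) j"
    have tz: "map z (subst v (v + j) ?t) = ?t"
    proof -
      have "subst v (v + j) ?t = ?t"
        unfolding subst_def by (rule map_idI) (use t(1)[of "len j" j] in auto)
      moreover have "map z ?t = ?t" by (rule map_idI) (use t(1)[of "len j" j] z(2) in auto)
      ultimately show ?thesis by simp
    qed
    have M: "map z (pre (Suc j)) = (p @ ?t) @ map z (subst v (v + j) [v])"
      using tz by (simp add: preS p_def y_def)
    have "(z \<circ> Z) i = (p @ ?t) ! i" if i: "i < length (p @ ?t)" for i
    proof -
      have L: "length (pre (Suc j)) = length (p @ ?t) + 1"
        using arg_cong[OF M, of length] by (simp add: subst_def)
      then have "(z \<circ> Z) i = map z (pre (Suc j)) ! i" using nthZ[of i "Suc j"] i by simp
      then show ?thesis unfolding M using i by (simp only: nth_append if_True)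
    qed
    then show ?thesis using t(2)[of "len j" j] pF zZ by blast
  qed
  moreover have "Z (v + i) = x ! i" if "i < length x" for i
    using nthZ[of "v + i" 0] that by (simp add: pre_def nth_append)
  ultimately show ?thesis using Z by blast
qed

text \<open>Genericity is used twice. A first generic point w has a color that, on generic points,
  is forced by a finite beginning of w; a second Z is then built to start with this beginning, and
  all \<open>z \<circ> Z\<close> are generic as well.\<close>

lemma borel_coloring_constant:
  fixes d :: "(nat \<Rightarrow> nat) \<Rightarrow> nat" and v :: nat
  assumes v: "0 < v" and borel: "\<And>c. d -` {c} \<in> sets borel"
  shows "\<exists>Z\<in>rsurj UNIV. (\<forall>i<v. Z i = i) \<and>
    (\<exists>c. \<forall>z\<in>rsurj {..<v}. (\<forall>i<v. z i = i) \<longrightarrow> d (z \<circ> Z) = c)"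
proof -
  define T where "T = {x :: nat \<Rightarrow> nat. (\<forall>i<v. x i = i) \<and> (\<forall>i. x i < v)}"
  obtain \<D> U where D: "\<And>c. countable (\<D> c)" "\<And>c. \<forall>D\<in>\<D> c. dense_open T D" "\<And>c. open (U c)"
      "\<And>c. \<forall>x\<in>T. (\<forall>D\<in>\<D> c. x \<in> D) \<longrightarrow> (x \<in> d -` {c} \<longleftrightarrow> x \<in> U c)"
    using borel_eq_open_on_dense_open[OF borel, of T] by metis
  \<comment> \<open>\<open>UNIV\<close> makes the family nonempty, so that
    \<open>from_nat_into\<close> enumerates it.\<close>
  define \<E> where "\<E> = insert UNIV (\<Union>c. \<D> c)"
  define E where "E = from_nat_into \<E>"
  have "range E = \<E>" unfolding E_def using D(1) by (intro range_from_nat_into) (auto simp: \<E>_def)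
  moreover have "dense_open T D" if "D \<in> \<E>" for D
    using that D(2) by (auto simp: \<E>_def dense_open_def)
  ultimately have E: "\<And>j. dense_open T (E j)" by auto
  have generic: "d x = c \<longleftrightarrow> x \<in> U c" if "x \<in> T" "\<And>j. x \<in> E j" for x c
  proof -
    have "\<forall>D\<in>\<D> c. x \<in> D" using that(2) \<open>range E = \<E>\<close> unfolding \<E>_def by blast
    then show ?thesis using D(4)[of c] that(1) by auto
  qed
  have inT: "z \<circ> Z \<in> T" if "z \<in> rsurj {..<v}" "\<forall>i<v. z i = i" "\<forall>i<v. Z i = i" for z Z
    using that by (auto simp: T_def rsurj_def)
  \<comment> \<open>Some surjection fixing the letters, wanted only to produce one generic
    point.\<close>
  define z0 where "z0 i = (if i < v then i else 0)" for i
  have "rigid z0"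
    unfolding rigid_def
  proof (intro allI impI)
    fix i j assume "j < z0 i"
    then show "\<exists>i'<i. z0 i' = j" by (intro exI[of _ j]) (auto simp: z0_def split: if_splits)
  qed
  moreover have "range z0 = {..<v}"
  proof
    show "{..<v} \<subseteq> range z0"
    proof
      fix i assume "i \<in> {..<v}"
      then have "z0 i = i" by (simp add: z0_def)
      then show "i \<in> range z0" by (metis rangeI)
    qed
  qed (use v in \<open>auto simp: z0_def\<close>)
  ultimately have z0: "z0 \<in> rsurj {..<v}" by (simp add: rsurj_def)
  obtain Z0 where Z0: "\<forall>i<v. Z0 i = i"
    "\<forall>z\<in>rsurj {..<v}. (\<forall>i<v. z i = i) \<longrightarrow> (\<forall>j. z \<circ> Z0 \<in> E j)"
    using generic_rsurj[where D = E and x = "[]", OF v E[unfolded T_def]] by auto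
  define w where "w = z0 \<circ> Z0"
  have w: "w \<in> T" "\<And>j. w \<in> E j"
    using inT[OF z0 _ Z0(1)] Z0(2) z0 by (auto simp: w_def z0_def)
  then have "w \<in> U (d w)" using generic by blast
  then obtain n where n: "\<forall>y. (\<forall>i<n. y i = w i) \<longrightarrow> y \<in> U (d w)"
    using open_contains_cylinder[OF D(3)] by blast
  have wv: "set (map w [v..<v + n]) \<subseteq> {..<v}" using w(1) by (auto simp: T_def)
  obtain Z where Z: "Z \<in> rsurj UNIV" "\<forall>i<v. Z i = i"
    "\<forall>i<length (map w [v..<v + n]). Z (v + i) = map w [v..<v + n] ! i"
    "\<forall>z\<in>rsurj {..<v}. (\<forall>i<v. z i = i) \<longrightarrow> (\<forall>j. z \<circ> Z \<in> E j)"
    using generic_rsurj[where D = E, OF v E[unfolded T_def] wv] by blast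
  have "d (z \<circ> Z) = d w" if z: "z \<in> rsurj {..<v}" "\<forall>i<v. z i = i" for z
  proof -
    \<comment> \<open>z fixes the letters, so the prescribed beginning of Z passes unchanged to
      \<open>z \<circ> Z\<close>.\<close>
    have "(z \<circ> Z) i = w i" if "i < n" for i
    proof (cases "i < v")
      case True
      then show ?thesis using z(2) Z(2) w(1) by (simp add: T_def)
    next
      case False
      then have "Z i = w i" using Z(3)[rule_format, of "i - v"] that by simp
      then show ?thesis using z(2) w(1) by (simp add: T_def)
    qed
    then have "z \<circ> Z \<in> U (d w)" using n by blast
    moreover have "\<And>j. z \<circ> Z \<in> E j" using Z(4) z by blast
    ultimately show ?thesis using generic[of "z \<circ> Z"] inT[OF z Z(2)] by blast
  qed
  then show ?thesis using Z(2) by (intro bexI[OF _ Z(1)] conjI exI[of _ "d w"]) auto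
qed

section \<open>The dual Ramsey theorem\<close>

lemma rigid_le: "rigid x \<Longrightarrow> x i \<le> i"
proof (induction i rule: less_induct)
  case (less i)
  show ?case
  proof (rule ccontr)
    assume "\<not> x i \<le> i"
    then obtain i' where "i' < i" "x i' = i" using less.prems unfolding rigid_def by (metis linorder_not_le)
    then show False using less.IH[of i'] less.prems by simp
  qed
qed

lemma id_rsurj: "id \<in> rsurj UNIV"
  by (auto simp: rsurj_def rigid_def)

text \<open>Requirement m is met by composing with a map that fixes 0, ..., m. A rigid map never
  exceeds its argument, so every coordinate of the growing composition is eventually constant and a
  limit exists.\<close>

lemma fusion:
  fixes P :: "nat \<Rightarrow> (nat \<Rightarrow> nat) \<Rightarrow> bool"
  assumes hereditary: "\<And>m X Z. P m X \<Longrightarrow> Z \<in> rsurj UNIV \<Longrightarrow> \<forall>i\<le>m. Z i = i \<Longrightarrow> P m (Z \<circ> X)"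
    and ex: "\<And>m X. X \<in> rsurj UNIV \<Longrightarrow> \<exists>Z\<in>rsurj UNIV. (\<forall>i\<le>m. Z i = i) \<and> P m (Z \<circ> X)"
  shows "\<exists>X\<in>rsurj UNIV. \<forall>m. P m X"
proof -
  define K where "K m X Z \<longleftrightarrow> (X \<in> rsurj UNIV \<longrightarrow>
    Z \<in> rsurj UNIV \<and> (\<forall>i\<le>m. Z i = i) \<and> P m (Z \<circ> X))" for m X Z
  have "\<exists>Z. K m X Z" for m X using ex unfolding K_def by blast
  then obtain \<zeta> where "\<And>m X. K m X (\<zeta> m X)" by metis
  then have \<zeta>: "\<zeta> m X \<in> rsurj UNIV \<and> (\<forall>i\<le>m. \<zeta> m X i = i) \<and> P m (\<zeta> m X \<circ> X)"
    if "X \<in> rsurj UNIV" for m X using that unfolding K_def by blast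
  define X where "X = rec_nat id (\<lambda>m X. \<zeta> m X \<circ> X)"
  have X0: "X 0 = id" and XS: "X (Suc m) = \<zeta> m (X m) \<circ> X m" for m
    by (simp_all add: X_def)
  have X: "X m \<in> rsurj UNIV" for m
  proof (induction m)
    case 0
    show ?case unfolding X0 by (rule id_rsurj)
  next
    case (Suc m)
    show ?case unfolding XS using \<zeta>[OF Suc] Suc by (intro rsurj_comp) blast+
  qed
  define Z where "Z m = \<zeta> m (X m)" for m
  have Z: "Z m \<in> rsurj UNIV" "\<And>i. i \<le> m \<Longrightarrow> Z m i = i" and PX: "P m (X (Suc m))" for m
    using \<zeta>[OF X] by (auto simp: Z_def XS)
  \<comment> \<open>The product of the l maps starting at stage a; its limit L a is needed for every
    a to split the full limit at an arbitrary stage.\<close>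
  define C where "C a = rec_nat id (\<lambda>l Y. Z (a + l) \<circ> Y)" for a
  have C0: "C a 0 = id" and CS: "C a (Suc l) = Z (a + l) \<circ> C a l" for a l
    by (simp_all add: C_def)
  have C: "C a l \<in> rsurj UNIV" for a l
  proof (induction l)
    case 0
    show ?case unfolding C0 by (rule id_rsurj)
  next
    case (Suc l)
    show ?case unfolding CS by (rule rsurj_comp[OF Z(1) Suc])
  qed
  have CX: "X (a + l) = C a l \<circ> X a" for a l
    by (induction l) (auto simp: C0 CS XS Z_def comp_assoc)
  \<comment> \<open>The stages from a + l' on fix all numbers up to a + l', so a value that small is
    final.\<close>
  have stable: "C a l i = C a l' i" if "l' \<le> l" "C a l' i \<le> a + l'" for a l l' i
    using that(1)
  proof (induction l rule: dec_induct)
    case (step l)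
    then show ?case using that(2) by (simp add: CS Z(2))
  qed simp
  have Cle: "C a l i \<le> i" for a l i using C rigid_le by (auto simp: rsurj_def)
  define L where "L a i = C a i i" for a i
  have L: "C a l i = L a i" if "i \<le> l" for a l i
    unfolding L_def by (rule stable[OF that]) (use Cle[of a i i] in linarith)
  have "L a \<in> rsurj UNIV" for a
  proof -
    have "\<exists>i'<i. L a i' = j" if j: "j < L a i" for i j
    proof -
      obtain i' where "i' < i" "C a i i' = j"
        using j C[of a i] unfolding L_def rsurj_def rigid_def by blast
      then show ?thesis using L[of i' i a] by auto
    qed
    moreover have "j \<in> range (L a)" for j
    proof -
      \<comment> \<open>The value j is attained at stage j and is stable from then on, so the limit
        is onto.\<close>
      obtain i where i: "C a j i = j" using C[of a j] unfolding rsurj_def by (metis (mono_tags, lifting) mem_Collect_eq surjD)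
      have "C a (max i j) i = j" using stable[of j "max i j" a i] i by simp
      then have "L a i = j" using L[of i "max i j" a] by simp
      then show ?thesis by blast
    qed
    ultimately show ?thesis by (auto simp: rsurj_def rigid_def)
  qed
  moreover have "L a i = i" if "i \<le> a" for a i
    using stable[of 0 i a i] that by (simp add: L_def C0)
  moreover have "L 0 = L a \<circ> X a" for a
  proof
    fix i
    have Xi: "X a i \<le> i" using X rigid_le by (auto simp: rsurj_def)
    have "L 0 i = X (a + i) i"
      using CX[of 0 "a + i"] L[of i "a + i" 0] by (simp add: X0)
    also have "\<dots> = L a (X a i)" using CX[of a i] L[OF Xi] by simp
    finally show "L 0 i = (L a \<circ> X a) i" by simp
  qed
  \<comment> \<open>\<open>L 0\<close> is \<open>L (Suc m) \<circ> X (Suc m)\<close>: requirement m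
    holds for \<open>X (Suc m)\<close>, and \<open>L (Suc m)\<close> fixes the numbers up to
    m.\<close>
  ultimately have "P m (L 0)" for m
    using hereditary[OF PX[of m], of "L (Suc m)"] by auto
  with \<open>\<And>a. L a \<in> rsurj UNIV\<close> show ?thesis by blast
qed

text \<open>A map \<open>x\<close> whose first value \<open>n\<close> occurs at \<open>m\<close> factors as \<open>s \<circ> z\<close>, where \<open>s\<close> is one of
  finitely many maps recording \<open>x\<close> up to \<open>m\<close>. For \<open>e = 0\<close> the value \<open>n + 1\<close> does not occur,
  for \<open>e = 1\<close> it is the largest one.\<close>

lemma stabilize:
  fixes c :: "(nat \<Rightarrow> nat) \<Rightarrow> nat" and n e :: nat
  assumes e: "e \<le> 1"
    and core: "\<And>m s X. rigid s \<Longrightarrow> s ` {..m} = {..n} \<Longrightarrow> \<forall>i>m. s i = Suc n \<Longrightarrow> X \<in> rsurj UNIV \<Longrightarrow>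
      \<exists>Z\<in>rsurj UNIV. (\<forall>i\<le>m. Z i = i) \<and>
        (\<exists>k. \<forall>z\<in>rsurj {..m + e}. (\<forall>i\<le>m. z i = i) \<longrightarrow> c (s \<circ> z \<circ> Z \<circ> X) = k)"
  shows "\<exists>X\<in>rsurj UNIV. \<forall>x\<in>rsurj {..n + e}. \<forall>x'\<in>rsurj {..n + e}.
    same_until n x x' \<longrightarrow> c (x \<circ> X) = c (x' \<circ> X)"
proof -
  \<comment> \<open>The padding n + 1 leaves s determined by its values up to m, so
    \<open>S m\<close> is finite; it is also the one new value in the case e = 1.\<close>
  define S where "S m = {s. rigid s \<and> s ` {..m} = {..n} \<and> (\<forall>i>m. s i = Suc n)}" for m
  define R where "R m = {z \<in> rsurj {..m + e}. \<forall>i\<le>m. z i = i}" for m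
  define P where "P m X \<longleftrightarrow> (\<forall>s\<in>S m. \<exists>k. \<forall>z\<in>R m. c (s \<circ> z \<circ> X) = k)" for m X
  have fin: "finite (S m)" for m
  proof (rule finite_subset)
    show "S m \<subseteq> (\<lambda>f i. if i \<le> m then f i else Suc n) ` ({..m} \<rightarrow>\<^sub>E {..n})"
    proof
      fix s assume s: "s \<in> S m"
      then have "s = (\<lambda>i. if i \<le> m then restrict s {..m} i else Suc n)" by (auto simp: S_def fun_eq_iff)
      moreover have "restrict s {..m} \<in> {..m} \<rightarrow>\<^sub>E {..n}" using s by (auto simp: S_def)
      ultimately show "s \<in> (\<lambda>f i. if i \<le> m then f i else Suc n) ` ({..m} \<rightarrow>\<^sub>E {..n})" by blast
    qed
  qed (auto intro: finite_PiE)
  have RZ: "z \<circ> Z \<in> R m" if "z \<in> R m" "Z \<in> rsurj UNIV" "\<forall>i\<le>m. Z i = i" for z Z m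
    using that by (auto simp: R_def rsurj_comp)
  have "\<exists>X\<in>rsurj UNIV. \<forall>m. P m X"
  proof (rule fusion)
    show "P m (Z \<circ> X)" if P: "P m X" and Z: "Z \<in> rsurj UNIV" "\<forall>i\<le>m. Z i = i" for m X Z
      unfolding P_def
    proof
      fix s assume "s \<in> S m"
      then obtain k where "\<forall>z\<in>R m. c (s \<circ> z \<circ> X) = k" using P unfolding P_def by blast
      then have "\<forall>z\<in>R m. c (s \<circ> (z \<circ> Z) \<circ> X) = k" using RZ Z by blast
      then show "\<exists>k. \<forall>z\<in>R m. c (s \<circ> z \<circ> (Z \<circ> X)) = k" unfolding comp_assoc by blast
    qed
    show "\<exists>Z\<in>rsurj UNIV. (\<forall>i\<le>m. Z i = i) \<and> P m (Z \<circ> X)" if X: "X \<in> rsurj UNIV" for m X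
    proof -
      have "\<exists>Z\<in>rsurj UNIV. (\<forall>i\<le>m. Z i = i) \<and> (\<forall>s\<in>F. \<exists>k. \<forall>z\<in>R m. c (s \<circ> z \<circ> Z \<circ> X) = k)"
        if "finite F" "F \<subseteq> S m" for F
        using that
      proof (induction F)
        case empty
        then show ?case using id_rsurj by (intro bexI[of _ id]) auto
      next
        case (insert s F)
        have sF: "s \<in> S m" "F \<subseteq> S m" using insert.prems by auto
        obtain Z where Z: "Z \<in> rsurj UNIV" "\<forall>i\<le>m. Z i = i"
          "\<forall>s\<in>F. \<exists>k. \<forall>z\<in>R m. c (s \<circ> z \<circ> Z \<circ> X) = k"
          using insert.IH[OF sF(2)] by blast
        have s: "rigid s" "s ` {..m} = {..n}" "\<forall>i>m. s i = Suc n" using sF(1) by (auto simp: S_def)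
        \<comment> \<open>The next s is treated inside the copy given by Z; earlier ones keep their
          color because \<open>z \<circ> Z'\<close> stays in \<open>R m\<close>.\<close>
        obtain Z' k where Z': "Z' \<in> rsurj UNIV" "\<forall>i\<le>m. Z' i = i"
          and k: "\<forall>z\<in>rsurj {..m + e}. (\<forall>i\<le>m. z i = i) \<longrightarrow> c (s \<circ> z \<circ> Z' \<circ> (Z \<circ> X)) = k"
          using core[OF s rsurj_comp[OF Z(1) X]] by blast
        have k': "\<forall>z\<in>R m. c (s \<circ> z \<circ> Z' \<circ> (Z \<circ> X)) = k" using k by (simp add: R_def)
        have "\<exists>k. \<forall>z\<in>R m. c (r \<circ> z \<circ> (Z' \<circ> Z) \<circ> X) = k" if r: "r \<in> insert s F" for r
        proof (cases "r = s")
          case True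
          then show ?thesis using k' unfolding comp_assoc by blast
        next
          case False
          then obtain k where "\<forall>z\<in>R m. c (r \<circ> z \<circ> Z \<circ> X) = k" using Z(3) r by blast
          then have "\<forall>z\<in>R m. c (r \<circ> (z \<circ> Z') \<circ> Z \<circ> X) = k" using RZ Z' by blast
          then show ?thesis unfolding comp_assoc by blast
        qed
        moreover have "Z' \<circ> Z \<in> rsurj UNIV" using Z(1) Z'(1) rsurj_comp by blast
        moreover have "\<forall>i\<le>m. (Z' \<circ> Z) i = i" using Z(2) Z'(2) by simp
        ultimately show ?case by blast
      qed
      then show ?thesis using fin[of m] unfolding P_def comp_assoc by blast
    qed
  qed
  then obtain X where X: "X \<in> rsurj UNIV" "\<And>m. P m X" by blast
  have factor: "\<exists>z\<in>R m. x = (\<lambda>i. if i \<le> m then x i else Suc n) \<circ> z \<and> (\<lambda>i. if i \<le> m then x i else Suc n) \<in> S m"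
    if x: "x \<in> rsurj {..n + e}" "x m = n" "\<forall>i<m. x i < n" for x m
  proof -
    let ?s = "\<lambda>i. if i \<le> m then x i else Suc n"
    have rig: "\<exists>i'<i. x i' = j" if "j < x i" for i j using x(1) that unfolding rsurj_def rigid_def by blast
    have xle: "x i \<le> n" if "i \<le> m" for i using that x(2,3) by (cases "i = m") (auto simp: less_imp_le)
    have ex: "\<exists>i\<le>m. x i = a" if "a \<le> n" for a
    proof (cases "a = n")
      case False
      then show ?thesis using rig[of a m] that x(2) by (auto intro: less_imp_le)
    qed (use x(2) in auto)
    have s: "?s \<in> S m"
    proof -
      have "\<exists>i'<i. ?s i' = j" if j: "j < ?s i" for i j
      proof (cases "i \<le> m")
        case True
        then obtain i' where "i' < i" "x i' = j" using rig[of j i] j by auto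
        then show ?thesis using True by (intro exI[of _ i']) auto
      next
        case False
        then have "j \<le> n" using j by auto
        then obtain i' where "i' \<le> m" "x i' = j" using ex by blast
        then show ?thesis using False by (intro exI[of _ i']) auto
      qed
      moreover have "?s ` {..m} = {..n}" using xle ex by (auto simp: image_iff)
      ultimately show ?thesis by (simp add: S_def rigid_def)
    qed
    obtain f where f: "\<And>a. a \<le> n \<Longrightarrow> f a \<le> m \<and> x (f a) = a" using ex by metis
    \<comment> \<open>After m, an old value of x is replaced by a position up to m where x has that
      value, and the new value n + 1 by the new number m + 1.\<close>
    define z where "z i = (if i \<le> m then i else if x i \<le> n then f (x i) else Suc m)" for i
    have xi: "x i \<le> n + e" for i using x(1) by (auto simp: rsurj_def)
    have big: "x i = Suc n \<and> e = 1" if "\<not> x i \<le> n" for i using xi[of i] that e by auto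
    have "x i = (?s \<circ> z) i" for i
      using f[of "x i"] big[of i] by (auto simp: z_def)
    then have "x = ?s \<circ> z" by blast
    moreover have "z \<in> R m"
    proof -
      have zle: "z i \<le> m + e" for i using f[of "x i"] big[of i] by (auto simp: z_def)
      have zi: "z i = i" if "i \<le> m" for i using that by (simp add: z_def)
      have "\<exists>i'<i. z i' = j" if j: "j < z i" for i j
      proof -
        have "j \<le> m" using j zle[of i] e by linarith
        moreover have "j < i" using j zi[of i] \<open>j \<le> m\<close> by (cases "i \<le> m") auto
        ultimately show ?thesis using zi[of j] by auto
      qed
      moreover have "j \<in> range z" if j: "j \<le> m + e" for j
      proof (cases "j \<le> m")
        case True
        then show ?thesis using zi by (metis rangeI)
      next
        case False
        then have "j = Suc m" "e = 1" using j e by auto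
        moreover obtain i where "x i = Suc n" using x(1) \<open>e = 1\<close> by (force simp: rsurj_def)
        moreover have "\<not> i \<le> m" using calculation(3) xle[of i] by auto
        ultimately have "z i = j" by (simp add: z_def)
        then show ?thesis by blast
      qed
      ultimately show ?thesis using zle zi by (auto simp: R_def rsurj_def rigid_def)
    qed
    ultimately show ?thesis using s by blast
  qed
  have "c (x \<circ> X) = c (x' \<circ> X)"
    if x: "x \<in> rsurj {..n + e}" "x' \<in> rsurj {..n + e}" "same_until n x x'" for x x'
  proof -
    obtain m where m: "x m = n" "x' m = n" "\<forall>i<m. x i = x' i \<and> x i < n"
      using x(3) by (auto simp: same_until_def)
    let ?s = "\<lambda>i. if i \<le> m then x i else Suc n"
    have "x' i = x i" if "i \<le> m" for i using that m by (cases "i = m") auto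
    then have s': "?s = (\<lambda>i. if i \<le> m then x' i else Suc n)" by auto
    have m': "\<forall>i<m. x i < n" "\<forall>i<m. x' i < n" using m by auto
    obtain z where z: "z \<in> R m" "x = ?s \<circ> z" "?s \<in> S m" using factor[OF x(1) m(1) m'(1)] by blast
    obtain z' where z': "z' \<in> R m" "x' = ?s \<circ> z'" using factor[OF x(2) m(2) m'(2)] s' by metis
    obtain k where "\<forall>z\<in>R m. c (?s \<circ> z \<circ> X) = k" using X(2)[of m] z(3) unfolding P_def by blast
    then show ?thesis using z z' by metis
  qed
  then show ?thesis using X(1) by blast
qed

lemma vimage_action_borel:
  fixes c :: "(nat \<Rightarrow> nat) \<Rightarrow> nat" and s X :: "nat \<Rightarrow> nat"
  assumes "c -` {k} \<in> sets borel"
  shows "(\<lambda>z. c (s \<circ> z \<circ> X)) -` {k} \<in> sets borel"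
proof -
  have "continuous_on UNIV (\<lambda>z :: nat \<Rightarrow> nat. s \<circ> z \<circ> X)"
  proof (rule continuous_on_coordinatewise_then_product)
    fix i
    have "continuous_on UNIV (\<lambda>z :: nat \<Rightarrow> nat. s (z (X i)))"
      by (rule continuous_on_compose2[of UNIV s]) auto
    then show "continuous_on UNIV (\<lambda>z :: nat \<Rightarrow> nat. (s \<circ> z \<circ> X) i)" by simp
  qed
  then have "(\<lambda>z :: nat \<Rightarrow> nat. s \<circ> z \<circ> X) -` (c -` {k}) \<inter> space borel \<in> sets borel"
    by (intro measurable_sets[OF borel_measurable_continuous_onI assms])
  then show ?thesis by (simp add: vimage_def)
qed

text \<open>The case e = 0 of \<open>stabilize\<close>: for each s the tails carry a Borel coloring,
  handled by \<open>borel_coloring_constant\<close> with v = m + 1.\<close>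

lemma borel_coloring_stabilize:
  fixes c :: "(nat \<Rightarrow> nat) \<Rightarrow> nat" and n :: nat
  assumes "\<And>k. c -` {k} \<in> sets borel"
  shows "\<exists>X\<in>rsurj UNIV. \<forall>x\<in>rsurj {..n}. \<forall>x'\<in>rsurj {..n}.
    same_until n x x' \<longrightarrow> c (x \<circ> X) = c (x' \<circ> X)"
proof -
  have "\<exists>Z\<in>rsurj UNIV. (\<forall>i\<le>m. Z i = i) \<and>
        (\<exists>k. \<forall>z\<in>rsurj {..m + 0}. (\<forall>i\<le>m. z i = i) \<longrightarrow> c (s \<circ> z \<circ> Z \<circ> X) = k)" for m s X
    using borel_coloring_constant[of "Suc m" "\<lambda>z. c (s \<circ> z \<circ> X)", OF _ vimage_action_borel[OF assms]]
    by (simp add: lessThan_Suc_atMost less_Suc_eq_le comp_assoc)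
  then show ?thesis using stabilize[of 0 n c] by simp
qed

text \<open>The case e = 1 of \<open>stabilize\<close>. Since s takes the value n + 1 exactly beyond
  m, the first n + 1 of \<open>s \<circ> z\<close> sits at the first m + 1 of z, and
  \<open>inv\<close> becomes the hypothesis of \<open>carlson_simpson\<close> with v = m +
  1.\<close>

lemma prefix_coloring_stabilize:
  fixes c :: "(nat \<Rightarrow> nat) \<Rightarrow> nat" and n b :: nat
  assumes inv: "\<And>x x'. x \<in> rsurj {..Suc n} \<Longrightarrow> x' \<in> rsurj {..Suc n} \<Longrightarrow> same_until (Suc n) x x' \<Longrightarrow> c x = c x'"
    and bounded: "\<And>x. c x < b"
  shows "\<exists>X\<in>rsurj UNIV. \<forall>x\<in>rsurj {..Suc n}. \<forall>x'\<in>rsurj {..Suc n}.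
    same_until n x x' \<longrightarrow> c (x \<circ> X) = c (x' \<circ> X)"
proof -
  have "\<exists>Z\<in>rsurj UNIV. (\<forall>i\<le>m. Z i = i) \<and>
        (\<exists>k. \<forall>z\<in>rsurj {..m + 1}. (\<forall>i\<le>m. z i = i) \<longrightarrow> c (s \<circ> z \<circ> Z \<circ> X) = k)"
    if s: "rigid s" "s ` {..m} = {..n}" "\<forall>i>m. s i = Suc n" and X: "X \<in> rsurj UNIV" for m s X
  proof -
    have comp: "s \<circ> z \<in> rsurj {..Suc n}" if z: "z \<in> rsurj {..Suc m}" for z
    proof -
      have "\<exists>i'<i. s (z i') = j" if "j < s (z i)" for i j
        using that s(1) z unfolding rsurj_def rigid_def by blast
      moreover have "range (s \<circ> z) = s ` {..Suc m}"
        using z image_comp[of s z UNIV] by (simp add: rsurj_def)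
      moreover have "s ` {..Suc m} = {..Suc n}" using s(2,3) by (simp add: atMost_Suc)
      ultimately show ?thesis by (simp add: rsurj_def rigid_def)
    qed
    have "c (s \<circ> z \<circ> X) = c (s \<circ> z' \<circ> X)"
      if z: "z \<in> rsurj {..Suc m}" "z' \<in> rsurj {..Suc m}" "same_until (Suc m) z z'" for z z'
    proof -
      obtain l where l: "z l = Suc m" "z' l = Suc m" "\<forall>i<l. z i = z' i \<and> z i < Suc m"
        using z(3) by (auto simp: same_until_def)
      have "s a < Suc n" if "a < Suc m" for a using that s(2) by (auto simp: less_Suc_eq_le)
      then have "same_until (Suc n) (s \<circ> z) (s \<circ> z')"
        unfolding same_until_def using l s(3) by (intro exI[of _ l]) (metis comp_apply lessI)
      then show ?thesis using inv rsurj_comp[OF comp X] same_until_comp[OF X] z by blast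
    qed
    then show ?thesis
      using carlson_simpson[of "Suc m" "\<lambda>z. c (s \<circ> z \<circ> X)" b] bounded
      by (simp add: lessThan_Suc_atMost less_Suc_eq_le comp_assoc)
  qed
  then show ?thesis using stabilize[of 1 n c] by simp
qed

text \<open>Stabilizing shortens the relevant prefix to the part before the first n. Such a prefix
  already belongs to a surjection onto {0, ..., n}, so the induction hypothesis applies.\<close>

lemma prefix_coloring_constant:
  fixes c :: "(nat \<Rightarrow> nat) \<Rightarrow> nat" and n b :: nat
  assumes "\<And>x x'. x \<in> rsurj {..n} \<Longrightarrow> x' \<in> rsurj {..n} \<Longrightarrow> same_until n x x' \<Longrightarrow> c x = c x'"
    and "\<And>x. c x < b"
  shows "\<exists>X\<in>rsurj UNIV. \<exists>k. \<forall>x\<in>rsurj {..n}. c (x \<circ> X) = k"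
  using assms
proof (induction n arbitrary: c)
  case 0
  have "x = (\<lambda>_. 0)" if "x \<in> rsurj {..0}" for x using that by (auto simp: rsurj_def)
  then have "c (x \<circ> id) = c (\<lambda>_. 0)" if "x \<in> rsurj {..0}" for x using that by (metis comp_id)
  then show ?case using id_rsurj by blast
next
  case (Suc n)
  obtain X1 where X1: "X1 \<in> rsurj UNIV"
    and inv: "\<forall>x\<in>rsurj {..Suc n}. \<forall>x'\<in>rsurj {..Suc n}. same_until n x x' \<longrightarrow> c (x \<circ> X1) = c (x' \<circ> X1)"
    using prefix_coloring_stabilize[of n c b] Suc.prems by blast
  \<comment> \<open>A canonical surjection onto {0, ..., n + 1} with the prefix of x: everything
    after the first n becomes n + 1.\<close>
  define ext where "ext x i = (if \<exists>j<i. x j = n then Suc n else x i)" for x :: "nat \<Rightarrow> nat" and i :: nat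
  have same_ext: "same_until n (ext x) x'" if xx': "same_until n x x'" for x x'
  proof -
    obtain m where m: "x m = n" "x' m = n" "\<forall>i<m. x i = x' i \<and> x i < n"
      using xx' by (auto simp: same_until_def)
    have "ext x i = x i" if "i \<le> m" for i
    proof -
      have "x j \<noteq> n" if "j < i" for j using that m(3) \<open>i \<le> m\<close> by (metis less_irrefl order.strict_trans2)
      then show ?thesis by (auto simp: ext_def)
    qed
    then show ?thesis unfolding same_until_def using m by (intro exI[of _ m]) auto
  qed
  have ext: "ext x \<in> rsurj {..Suc n}" if x: "x \<in> rsurj {..n}" for x
  proof -
    have xr: "rigid x" "range x = {..n}" using x by (auto simp: rsurj_def)
    obtain m where m: "x m = n" "\<forall>i<m. x i < n"
      using rigid_first_occurrence[OF xr(1), of n] xr(2) by auto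
    have ext_eq: "ext x i = (if i \<le> m then x i else Suc n)" for i
    proof (cases "i \<le> m")
      case True
      then have "\<not> (\<exists>j<i. x j = n)" using m(2) by (metis less_irrefl order.strict_trans2)
      then show ?thesis using True by (auto simp: ext_def)
    next
      case False
      then show ?thesis using m(1) by (auto simp: ext_def not_le)
    qed
    have early: "\<exists>i\<le>m. x i = a" if "a \<le> n" for a
      using m(1) xr(1) that unfolding rigid_def by (metis le_neq_implies_less less_imp_le order_refl)
    have "\<exists>i'<i. ext x i' = j" if j: "j < ext x i" for i j
    proof (cases "i \<le> m")
      case True
      then obtain i' where "i' < i" "x i' = j" using j xr(1) unfolding ext_eq rigid_def by auto
      then show ?thesis using True by (intro exI[of _ i']) (auto simp: ext_eq)
    next
      case False
      then have "j \<le> n" using j by (auto simp: ext_eq)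
      then obtain i' where "i' \<le> m" "x i' = j" using early by blast
      then show ?thesis using False by (intro exI[of _ i']) (auto simp: ext_eq)
    qed
    moreover have "range (ext x) = {..Suc n}"
    proof
      have "x i \<le> n" for i using xr(2) by auto
      then show "range (ext x) \<subseteq> {..Suc n}" by (auto simp: ext_eq le_SucI)
      show "{..Suc n} \<subseteq> range (ext x)"
      proof
        fix a assume a: "a \<in> {..Suc n}"
        show "a \<in> range (ext x)"
        proof (cases "a \<le> n")
          case True
          then obtain i where "i \<le> m" "x i = a" using early by blast
          then have "ext x i = a" by (simp add: ext_eq)
          then show ?thesis by blast
        next
          case False
          then have "ext x (Suc m) = a" using a by (auto simp: ext_eq)
          then show ?thesis by blast
        qed
      qed
    qed
    ultimately show ?thesis by (simp add: rsurj_def rigid_def)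
  qed
  have "c (ext x \<circ> X1) = c (ext x' \<circ> X1)"
    if "x \<in> rsurj {..n}" "x' \<in> rsurj {..n}" "same_until n x x'" for x x'
    using that ext inv same_ext same_until_sym by blast
  then obtain X2 k where X2: "X2 \<in> rsurj UNIV" "\<forall>x\<in>rsurj {..n}. c (ext (x \<circ> X2) \<circ> X1) = k"
    using Suc.IH[of "\<lambda>x. c (ext x \<circ> X1)"] Suc.prems(2) by blast
  have "c (x \<circ> (X2 \<circ> X1)) = k" if x: "x \<in> rsurj {..Suc n}" for x
  proof -
    have xr: "rigid x" "range x = {..Suc n}" using x by (auto simp: rsurj_def)
    \<comment> \<open>Merging n + 1 into n keeps the part before the first n, so the color of x can
      be read off from \<open>ext\<close>.\<close>
    define y where "y i = min (x i) n" for i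
    have "y \<in> rsurj {..n}"
    proof -
      have "\<exists>i'<i. y i' = j" if "j < y i" for i j
      proof -
        have "j < x i" using that by (simp add: y_def)
        then obtain i' where "i' < i" "x i' = j" using xr(1) unfolding rigid_def by blast
        then show ?thesis using that by (intro exI[of _ i']) (auto simp: y_def)
      qed
      moreover have "a \<in> range y" if "a \<le> n" for a
      proof -
        have "a \<in> range x" using that xr(2) by auto
        then obtain i where "x i = a" by auto
        then have "y i = a" using that by (simp add: y_def)
        then show ?thesis by blast
      qed
      ultimately show ?thesis by (auto simp: rsurj_def rigid_def y_def)
    qed
    moreover have "same_until n y x"
    proof -
      have "n \<in> range x" using xr(2) by simp
      then obtain m where "x m = n" "\<forall>i<m. x i < n"
        using rigid_first_occurrence[OF xr(1)] by blast
      then show ?thesis unfolding same_until_def by (intro exI[of _ m]) (auto simp: y_def)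
    qed
    then have "same_until n (ext (y \<circ> X2)) (x \<circ> X2)"
      using same_ext same_until_comp[OF X2(1)] by blast
    ultimately have "c (x \<circ> X2 \<circ> X1) = c (ext (y \<circ> X2) \<circ> X1)"
      using inv ext rsurj_comp X2(1) x by metis
    then show ?thesis using X2(2) \<open>y \<in> rsurj {..n}\<close> by (simp add: comp_assoc)
  qed
  then show ?case using rsurj_comp[OF X2(1) X1] by blast
qed

theorem dual_Ramsey:
  fixes c :: "(nat \<Rightarrow> nat) \<Rightarrow> nat" and n b :: nat
  assumes "\<And>k. c -` {k} \<in> sets borel" and "\<And>x. c x < b"
  shows "\<exists>X\<in>rsurj UNIV. \<exists>k. \<forall>x\<in>rsurj {..n}. c (x \<circ> X) = k"
proof -
  obtain X1 where X1: "X1 \<in> rsurj UNIV"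
    and inv: "\<forall>x\<in>rsurj {..n}. \<forall>x'\<in>rsurj {..n}. same_until n x x' \<longrightarrow> c (x \<circ> X1) = c (x' \<circ> X1)"
    using borel_coloring_stabilize[OF assms(1)] by blast
  obtain X2 k where X2: "X2 \<in> rsurj UNIV" and k: "\<forall>x\<in>rsurj {..n}. c (x \<circ> X2 \<circ> X1) = k"
    using prefix_coloring_constant[of n "\<lambda>x. c (x \<circ> X1)" b] inv assms(2) by blast
  then show ?thesis using rsurj_comp[OF X2 X1] unfolding comp_assoc by blast
qed

text \<open>The colorings are treated in turn; further thinning preserves constancy because
  \<open>rsurj\<close> is closed under composition with \<open>rsurj UNIV\<close>.\<close>

lemma dual_Ramsey_finitely_many:
  fixes c :: "'i \<Rightarrow> (nat \<Rightarrow> nat) \<Rightarrow> nat" and n b :: "'i \<Rightarrow> nat"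
  assumes "finite I" and borel: "\<And>i k. c i -` {k} \<in> sets borel" and bounded: "\<And>i x. c i x < b i"
  shows "\<exists>X\<in>rsurj UNIV. \<forall>i\<in>I. \<exists>k. \<forall>x\<in>rsurj {..n i}. c i (x \<circ> X) = k"
  using assms(1)
proof induction
  case empty
  then show ?case using id_rsurj by auto
next
  case (insert i I)
  obtain X where X: "X \<in> rsurj UNIV" "\<forall>i\<in>I. \<exists>k. \<forall>x\<in>rsurj {..n i}. c i (x \<circ> X) = k"
    using insert.IH by blast
  have "(\<lambda>x. c i (x \<circ> X)) -` {k} \<in> sets borel" for k
    using vimage_action_borel[OF borel[of i k], of id X] by simp
  then obtain Y k where Y: "Y \<in> rsurj UNIV" and k: "\<forall>x\<in>rsurj {..n i}. c i (x \<circ> Y \<circ> X) = k"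
    using dual_Ramsey[of "\<lambda>x. c i (x \<circ> X)" "b i" "n i"] bounded by blast
  have "\<exists>k. \<forall>x\<in>rsurj {..n j}. c j (x \<circ> (Y \<circ> X)) = k" if j: "j \<in> insert i I" for j
  proof (cases "j = i")
    case True
    then show ?thesis using k unfolding comp_assoc by blast
  next
    case False
    then obtain k where "\<forall>x\<in>rsurj {..n j}. c j (x \<circ> X) = k" using X(2) j by blast
    then have "\<forall>x\<in>rsurj {..n j}. c j (x \<circ> Y \<circ> X) = k" using rsurj_comp Y by blast
    then show ?thesis unfolding comp_assoc by blast
  qed
  then show ?case using rsurj_comp[OF Y X(1)] by blast
qed

section \<open>Embeddings as words\<close>

text \<open>\<open>\<rho>\<close> sends a position to the first one with the same letter. Numbering
  these first positions in increasing order is what makes x rigid.\<close>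

lemma enumerate_by_first_occurrence:
  fixes F :: "nat \<Rightarrow> 'b"
  assumes "finite (range F)"
  shows "\<exists>\<sigma> x. distinct \<sigma> \<and> set \<sigma> = range F \<and> x \<in> rsurj {..<length \<sigma>} \<and> (\<forall>i. F i = \<sigma> ! x i)"
proof -
  define \<rho> where "\<rho> i = (LEAST j. F j = F i)" for i
  have F\<rho>: "F (\<rho> i) = F i" for i unfolding \<rho>_def by (rule LeastI) simp
  have \<rho>le: "\<rho> i \<le> j" if "F j = F i" for i j unfolding \<rho>_def using that by (rule Least_le)
  have \<rho>\<rho>: "\<rho> (\<rho> i) = \<rho> i" for i by (simp add: \<rho>_def[of "\<rho> i"] F\<rho>) (simp add: \<rho>_def)
  have inj: "inj_on F (range \<rho>)"
    by (rule inj_onI) (metis \<rho>\<rho> \<rho>_def imageE)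
  have "F ` range \<rho> = range F" using F\<rho> by (auto simp: image_iff)
  then have fin: "finite (range \<rho>)" using assms inj by (metis finite_image_iff)
  define ls where "ls = sorted_list_of_set (range \<rho>)"
  have ls: "set ls = range \<rho>" "distinct ls" "sorted ls" using fin by (auto simp: ls_def)
  have "\<exists>a<length ls. ls ! a = \<rho> i" for i using ls(1) by (metis in_set_conv_nth rangeI)
  then obtain x where x: "\<And>i. x i < length ls" "\<And>i. ls ! x i = \<rho> i" by metis
  have xls: "x (ls ! a) = a" if a: "a < length ls" for a
  proof -
    have "ls ! a \<in> range \<rho>" using a ls(1) nth_mem by blast
    then have "\<rho> (ls ! a) = ls ! a" using \<rho>\<rho> by auto
    then show ?thesis using x a ls(2) by (metis nth_eq_iff_index_eq)
  qed
  have "\<exists>i'<i. x i' = j" if j: "j < x i" for i j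
  proof -
    have jl: "j < length ls" using j x(1)[of i] by simp
    have "ls ! j \<le> ls ! x i" using ls(3) j x(1)[of i] by (simp add: sorted_nth_mono)
    moreover have "ls ! j \<noteq> ls ! x i" using ls(2) j jl x(1)[of i] by (simp add: nth_eq_iff_index_eq)
    moreover have "ls ! x i \<le> i" using \<rho>le x(2) by simp
    ultimately have "ls ! j < i" by simp
    then show ?thesis using xls[OF jl] by blast
  qed
  moreover have "range x = {..<length ls}"
  proof
    show "{..<length ls} \<subseteq> range x" using xls by (metis lessThan_iff rangeI subsetI)
  qed (use x(1) in auto)
  ultimately have "x \<in> rsurj {..<length (map F ls)}" by (simp add: rsurj_def rigid_def)
  moreover have "distinct (map F ls)" using ls inj by (simp add: distinct_map)
  moreover have "set (map F ls) = range F" using ls(1) \<open>F ` range \<rho> = range F\<close> by simp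
  moreover have "\<forall>i. F i = map F ls ! x i" using x F\<rho> by simp
  ultimately show ?thesis by blast
qed

definition word_map :: "cantor set \<Rightarrow> (cantor \<Rightarrow> bool) list \<Rightarrow> (nat \<Rightarrow> nat) \<Rightarrow> cantor \<Rightarrow> cantor" where
  "word_map A \<sigma> x = (\<lambda>a\<in>A. \<lambda>m. (\<sigma> ! x m) a)"

lemma word_map_exists:
  assumes "finite A" and "e \<in> extensional A"
  shows "\<exists>\<sigma> x. distinct \<sigma> \<and> set \<sigma> \<subseteq> A \<rightarrow>\<^sub>E UNIV \<and> x \<in> rsurj {..<length \<sigma>} \<and> e = word_map A \<sigma> x"
proof -
  \<comment> \<open>Restricting the columns of e to A leaves finitely many letters.\<close>
  define F where "F m = (\<lambda>a\<in>A. e a m)" for m :: nat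
  have FA: "range F \<subseteq> A \<rightarrow>\<^sub>E UNIV" by (auto simp: F_def)
  then have "finite (range F)" using assms(1) by (meson finite finite_PiE finite_subset)
  then obtain \<sigma> x where \<sigma>: "distinct \<sigma>" "set \<sigma> = range F" "x \<in> rsurj {..<length \<sigma>}" "\<forall>i. F i = \<sigma> ! x i"
    using enumerate_by_first_occurrence by blast
  have "e a = word_map A \<sigma> x a" for a
  proof (cases "a \<in> A")
    case True
    have "e a m = (\<sigma> ! x m) a" for m using \<sigma>(4)[rule_format, of m, symmetric] True by (simp add: F_def)
    then show ?thesis using True by (auto simp: word_map_def)
  next
    case False
    then show ?thesis using assms(2) by (simp add: word_map_def extensional_def)
  qed
  then have "e = word_map A \<sigma> x" by blast
  then show ?thesis using \<sigma> FA by blast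
qed

text \<open>The list is untouched: this is why the number of lists bounds the number of
  colors.\<close>

lemma compose_word_map: "compose A (\<lambda>f. f \<circ> X) (word_map A \<sigma> x) = word_map A \<sigma> (x \<circ> X)"
  by (auto simp: compose_def word_map_def fun_eq_iff)

lemma continuous_map_word_map:
  "continuous_map euclidean (product_topology (\<lambda>_. cantor_topology) A) (word_map A \<sigma>)"
proof -
  have "continuous_map euclidean cantor_topology (\<lambda>x. word_map A \<sigma> x a)" if "a \<in> A" for a
  proof -
    have "continuous_on UNIV (\<lambda>x m. (\<sigma> ! x m) a)"
    proof (rule continuous_on_coordinatewise_then_product)
      fix m
      show "continuous_on UNIV (\<lambda>x. (\<sigma> ! x m) a)"
        by (rule continuous_on_compose2[of UNIV "\<lambda>i. (\<sigma> ! i) a"]) auto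
    qed
    then show ?thesis using that by (simp add: cantor_topology_eq_euclidean word_map_def)
  qed
  then show ?thesis
    by (auto simp: continuous_map_componentwise word_map_def)
qed

text \<open>The coloring lives on the subspace \<open>Emb\<close>, so its classes pull back to Borel
  sets only relative to the words that are embeddings; H is a Borel set of the whole space with the
  right trace.\<close>

lemma borel_vimage_word_map:
  assumes "E \<in> borel_sets_of (Emb_topology (induced C A) C)"
  shows "\<exists>H\<in>sets borel. \<forall>x. word_map A \<sigma> x \<in> Emb (induced C A) C \<longrightarrow> (word_map A \<sigma> x \<in> E \<longleftrightarrow> x \<in> H)"
  using assms unfolding borel_sets_of_def topspace_Emb_topology
proof induction
  case (Basic U)
  then obtain V where V: "openin (product_topology (\<lambda>_. cantor_topology) A) V"
    "U = V \<inter> Emb (induced C A) C"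
    by (auto simp: Emb_topology_def openin_subtopology induced_def)
  have "openin euclidean {x \<in> topspace euclidean. word_map A \<sigma> x \<in> V}"
    by (rule openin_continuous_map_preimage[OF continuous_map_word_map V(1)])
  then have "{x. word_map A \<sigma> x \<in> V} \<in> sets borel" by simp
  then show ?case using V(2) by (intro bexI[of _ "{x. word_map A \<sigma> x \<in> V}"]) auto
next
  case Empty
  then show ?case by (intro bexI[of _ "{}"]) auto
next
  case (Compl E)
  then obtain H where "H \<in> sets borel"
    "\<forall>x. word_map A \<sigma> x \<in> Emb (induced C A) C \<longrightarrow> (word_map A \<sigma> x \<in> E \<longleftrightarrow> x \<in> H)" by blast
  then show ?case by (intro bexI[of _ "- H"]) (auto simp: borel_comp)
next
  case (Union E)
  then have "\<forall>i. \<exists>H. H \<in> sets borel \<and>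
    (\<forall>x. word_map A \<sigma> x \<in> Emb (induced C A) C \<longrightarrow> (word_map A \<sigma> x \<in> E i \<longleftrightarrow> x \<in> H))" by blast
  then obtain H where "\<And>i. H i \<in> sets borel"
    "\<And>i x. word_map A \<sigma> x \<in> Emb (induced C A) C \<Longrightarrow> (word_map A \<sigma> x \<in> E i \<longleftrightarrow> x \<in> H i)" by metis
  then show ?case by (intro bexI[of _ "\<Union>i. H i"]) auto
qed

lemma borel_coloring_word_map:
  assumes "borel_coloring (Emb_topology (induced C A) C) k \<gamma>"
  shows "\<exists>c. (\<forall>j. c -` {j} \<in> sets borel) \<and> (\<forall>x. c x < Suc k) \<and>
    (\<forall>x. word_map A \<sigma> x \<in> Emb (induced C A) C \<longrightarrow> c x = \<gamma> (word_map A \<sigma> x))"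
proof -
  let ?E = "Emb (induced C A) C"
  have \<gamma>: "\<gamma> \<in> ?E \<rightarrow> {..<k}" "\<And>i. i < k \<Longrightarrow> {e \<in> ?E. \<gamma> e = i} \<in> borel_sets_of (Emb_topology (induced C A) C)"
    using assms by (auto simp: borel_coloring_def topspace_Emb_topology)
  have "\<forall>i. \<exists>H. H \<in> sets borel \<and> (i < k \<longrightarrow>
      (\<forall>x. word_map A \<sigma> x \<in> ?E \<longrightarrow> (\<gamma> (word_map A \<sigma> x) = i \<longleftrightarrow> x \<in> H)))"
    using borel_vimage_word_map[OF \<gamma>(2), of _ \<sigma>] sets.empty_sets by (smt (verit, best) mem_Collect_eq)
  then obtain H where H: "\<And>i. H i \<in> sets borel"
    "\<And>i x. i < k \<Longrightarrow> word_map A \<sigma> x \<in> ?E \<Longrightarrow> (\<gamma> (word_map A \<sigma> x) = i \<longleftrightarrow> x \<in> H i)" by metis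
  \<comment> \<open>A total Borel function extending the pulled-back coloring. The cap k takes care
    of points in no \<open>H j\<close> with j < k, whence the bound \<open>Suc k\<close>.\<close>
  define c where "c x = (LEAST j. x \<in> H j \<or> k \<le> j)" for x
  have [measurable]: "\<And>i. Measurable.pred borel (\<lambda>x. x \<in> H i)" using H(1) by measurable
  have "c \<in> borel \<rightarrow>\<^sub>M count_space UNIV" unfolding c_def by measurable
  then have "c -` {j} \<in> sets borel" for j using measurable_sets[of c borel "count_space UNIV" "{j}"] by simp
  moreover have "c x < Suc k" for x unfolding c_def less_Suc_eq_le by (rule Least_le) simp
  moreover have "c x = \<gamma> (word_map A \<sigma> x)" if x: "word_map A \<sigma> x \<in> ?E" for x
  proof -
    have k: "\<gamma> (word_map A \<sigma> x) < k" using \<gamma>(1) x by auto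
    show ?thesis unfolding c_def
    proof (rule Least_equality)
      show "x \<in> H (\<gamma> (word_map A \<sigma> x)) \<or> k \<le> \<gamma> (word_map A \<sigma> x)" using H(2)[OF k x] by simp
      show "\<gamma> (word_map A \<sigma> x) \<le> j" if "x \<in> H j \<or> k \<le> j" for j
        using that H(2)[OF _ x, of j] k by (cases "j < k") auto
    qed
  qed
  ultimately show ?thesis by blast
qed

section \<open>The eight structures\<close>

text \<open>The symbolwise part of \<open>fo_isomorphism\<close> when source and target both come
  from C, so that each symbol is matched with itself.\<close>

definition preserves :: "'a fo_structure \<Rightarrow> 'a set \<Rightarrow> ('a \<Rightarrow> 'a) \<Rightarrow> bool" where
  "preserves C A \<phi> \<longleftrightarrow>
    (\<forall>(n, R)\<in>set (rels C). \<forall>xs. length xs = n \<and> set xs \<subseteq> A \<longrightarrow> (R xs \<longleftrightarrow> R (map \<phi> xs))) \<and>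
    (\<forall>(n, F)\<in>set (ops C). \<forall>xs. length xs = n \<and> set xs \<subseteq> A \<longrightarrow> \<phi> (F xs) = F (map \<phi> xs))"

lemma preserves_rels:
  "preserves C A \<phi> \<Longrightarrow> (length xs, R) \<in> set (rels C) \<Longrightarrow> set xs \<subseteq> A \<Longrightarrow> R (map \<phi> xs) \<longleftrightarrow> R xs"
  by (auto simp: preserves_def)

lemma preserves_ops:
  "preserves C A \<phi> \<Longrightarrow> (length xs, F) \<in> set (ops C) \<Longrightarrow> set xs \<subseteq> A \<Longrightarrow> F (map \<phi> xs) = \<phi> (F xs)"
  by (auto simp: preserves_def)

lemma preservesI:
  assumes "\<And>R xs. (length xs, R) \<in> set (rels C) \<Longrightarrow> set xs \<subseteq> A \<Longrightarrow> R (map \<phi> xs) \<longleftrightarrow> R xs"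
    and "\<And>F xs. (length xs, F) \<in> set (ops C) \<Longrightarrow> set xs \<subseteq> A \<Longrightarrow> F (map \<phi> xs) = \<phi> (F xs)"
  shows "preserves C A \<phi>"
  using assms by (auto simp: preserves_def)

lemma closed_under_opsD:
  "closed_under_ops C A \<Longrightarrow> (length xs, F) \<in> set (ops C) \<Longrightarrow> set xs \<subseteq> A \<Longrightarrow> F xs \<in> A"
  by (auto simp: closed_under_ops_def)

lemma closed_under_ops_image:
  assumes "closed_under_ops C A" and "preserves C A \<phi>"
  shows "closed_under_ops C (\<phi> ` A)"
proof -
  have "F ys \<in> \<phi> ` A" if nF: "(length ys, F) \<in> set (ops C)" and ys: "set ys \<subseteq> \<phi> ` A" for F ys
  proof -
    have "ys \<in> lists (\<phi> ` A)" using ys by auto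
    then obtain xs where xs: "ys = map \<phi> xs" "set xs \<subseteq> A" unfolding lists_image by auto
    have nF': "(length xs, F) \<in> set (ops C)" using nF xs(1) by simp
    show ?thesis
      unfolding xs(1) preserves_ops[OF assms(2) nF' xs(2)]
      by (rule imageI[OF closed_under_opsD[OF assms(1) nF' xs(2)]])
  qed
  then show ?thesis by (auto simp: closed_under_ops_def)
qed

lemma fo_embedding_induced_iff:
  assumes "closed_under_ops C A" and "K \<subseteq> carrier C"
  shows "fo_embedding (induced C A) (induced C K) \<phi> \<longleftrightarrow> inj_on \<phi> A \<and> \<phi> ` A \<subseteq> K \<and> preserves C A \<phi>"
proof -
  have "fo_isomorphism (induced C A) (induced (induced C K) (\<phi> ` A)) \<phi> \<longleftrightarrow>
      bij_betw \<phi> A (\<phi> ` A) \<and> preserves C A \<phi>"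
    unfolding fo_isomorphism_def preserves_def induced_def by (auto simp: list_all2_same)
  moreover have "closed_under_ops (induced C K) (\<phi> ` A) \<longleftrightarrow> closed_under_ops C (\<phi> ` A)"
    by (simp add: closed_under_ops_def induced_def)
  moreover have "carrier (induced C B) = B" for B by (simp add: induced_def)
  ultimately show ?thesis
    using closed_under_ops_image[OF assms(1), of \<phi>]
    by (auto simp: fo_embedding_def is_substructure_def inj_on_imp_bij_betw)
qed

lemma induced_carrier [simp]: "induced C (carrier C) = C"
  by (simp add: induced_def)

lemma Emb_induced:
  assumes "closed_under_ops C A" and "K \<subseteq> carrier C"
  shows "Emb (induced C A) (induced C K) = {\<phi> \<in> A \<rightarrow>\<^sub>E K. inj_on \<phi> A \<and> preserves C A \<phi>}"
  using fo_embedding_induced_iff[OF assms] by (auto simp: Emb_def induced_def PiE_iff)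

lemma preserves_comp:
  assumes "preserves C A \<phi>" and "preserves C UNIV g"
  shows "preserves C A (g \<circ> \<phi>)"
proof (rule preservesI)
  fix R xs assume "(length xs, R) \<in> set (rels C)" "set xs \<subseteq> A"
  then show "R (map (g \<circ> \<phi>) xs) \<longleftrightarrow> R xs"
    using preserves_rels[OF assms(1), of xs R] preserves_rels[OF assms(2), of "map \<phi> xs" R] by simp
next
  fix F xs assume "(length xs, F) \<in> set (ops C)" "set xs \<subseteq> A"
  then show "F (map (g \<circ> \<phi>) xs) = (g \<circ> \<phi>) (F xs)"
    using preserves_ops[OF assms(1), of xs F] preserves_ops[OF assms(2), of "map \<phi> xs" F] by simp
qed

lemma preserves_cancel:
  assumes "preserves C A (g \<circ> \<phi>)" and "preserves C UNIV g" and "inj g"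
  shows "preserves C A \<phi>"
proof (rule preservesI)
  fix R xs assume "(length xs, R) \<in> set (rels C)" "set xs \<subseteq> A"
  then show "R (map \<phi> xs) \<longleftrightarrow> R xs"
    using preserves_rels[OF assms(1), of xs R] preserves_rels[OF assms(2), of "map \<phi> xs" R] by simp
next
  fix F xs assume "(length xs, F) \<in> set (ops C)" "set xs \<subseteq> A"
  then have "g (F (map \<phi> xs)) = g (\<phi> (F xs))"
    using preserves_ops[OF assms(1), of xs F] preserves_ops[OF assms(2), of "map \<phi> xs" F] by simp
  then show "F (map \<phi> xs) = \<phi> (F xs)" using assms(3) by (simp add: inj_eq)
qed

lemma preserves_cong:
  assumes "\<And>a. a \<in> A \<Longrightarrow> \<phi> a = \<psi> a" and "closed_under_ops C A"
  shows "preserves C A \<phi> \<longleftrightarrow> preserves C A \<psi>"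
proof -
  have m: "map \<phi> xs = map \<psi> xs" if "set xs \<subseteq> A" for xs using assms(1) that by (auto intro: map_cong)
  have f: "\<phi> (F xs) = \<psi> (F xs)" if "(length xs, F) \<in> set (ops C)" "set xs \<subseteq> A" for F xs
    using assms(1) closed_under_opsD[OF assms(2) that] by simp
  show ?thesis
    unfolding preserves_def
    by (intro arg_cong2[where f = "(\<and>)"] ball_cong refl) (auto simp: m f)
qed

text \<open>At the first position q where X hits D', its value exceeds the least element of D; by
  rigidity X takes that element before q.\<close>

lemma Least_vimage_less:
  assumes "rigid X" and "range X = UNIV" and "D \<noteq> {}" "D' \<noteq> {}"
    and less: "(LEAST m. m \<in> D) < (LEAST m. m \<in> D')"
  shows "(LEAST m. m \<in> X -` D) < (LEAST m. m \<in> X -` D')"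
proof -
  define q where "q = (LEAST m. m \<in> X -` D')"
  obtain d where "d \<in> D'" using assms(4) by auto
  then obtain i where "X i \<in> D'" using assms(2) by (metis surjD)
  then have "X q \<in> D'" unfolding q_def using LeastI[of "\<lambda>m. m \<in> X -` D'" i] by simp
  then have "(LEAST m. m \<in> D) < X q" using less Least_le[of "\<lambda>m. m \<in> D'" "X q"] by simp
  then obtain i' where i': "i' < q" "X i' = (LEAST m. m \<in> D)" using assms(1) unfolding rigid_def by blast
  have "(LEAST m. m \<in> D) \<in> D" using assms(3) by (metis LeastI ex_in_conv)
  then have "(LEAST m. m \<in> X -` D) \<le> i'" using i'(2) by (intro Least_le) simp
  then show ?thesis using i'(1) by (simp add: q_def)
qed

lemma lex_le_comp:
  assumes X: "X \<in> rsurj UNIV"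
  shows "lex_le (f \<circ> X) (g \<circ> X) \<longleftrightarrow> lex_le f g"
proof -
  have X': "rigid X" "range X = UNIV" using X by (auto simp: rsurj_def)
  have supp: "supp (h \<circ> X) = X -` supp h" for h by (auto simp: supp_def)
  have sub: "X -` D \<subseteq> X -` D' \<longleftrightarrow> D \<subseteq> D'" for D D'
    using X'(2) by (metis subset_vimage_iff surj_image_vimage_eq image_mono vimage_mono)
  have "(LEAST m. m \<in> X -` D) < (LEAST m. m \<in> X -` D') \<longleftrightarrow> (LEAST m. m \<in> D) < (LEAST m. m \<in> D')"
    if D: "D \<noteq> {}" "D' \<noteq> {}" "D \<inter> D' = {}" for D D'
  proof -
    have "(LEAST m. m \<in> D) \<in> D" "(LEAST m. m \<in> D') \<in> D'"
      using D(1,2) by (metis LeastI ex_in_conv)+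
    then have "(LEAST m. m \<in> D) \<noteq> (LEAST m. m \<in> D')" using D(3) by auto
    \<comment> \<open>Disjointness makes the two minima distinct, so the converse is the same
      implication with D and D' exchanged.\<close>
    then show ?thesis
      using Least_vimage_less[OF X' D(1,2)] Least_vimage_less[OF X' D(2,1)] by (meson linorder_neqE_nat order_less_asym)
  qed
  from this[of "supp g - supp f" "supp f - supp g"]
  have "(LEAST m. m \<in> X -` supp g - X -` supp f) < (LEAST m. m \<in> X -` supp f - X -` supp g) \<longleftrightarrow>
      (LEAST m. m \<in> supp g - supp f) < (LEAST m. m \<in> supp f - supp g)"
    if "\<not> supp f \<subseteq> supp g" "\<not> supp g \<subseteq> supp f"
    using that by (auto simp: vimage_Diff)
  then show ?thesis unfolding lex_le_def Let_def supp sub by blast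
qed

text \<open>Surjectivity of X settles \<open>sq_le\<close> and \<open>adj\<close>, the operations
  commute with reindexing, and rigidity enters through \<open>lex_le_comp\<close>.\<close>

lemma preserves_comp_rsurj:
  assumes C: "C \<in> {struct_Q, struct_EQ, struct_G, struct_OG, struct_B, struct_EB, struct_L, struct_EL}"
    and X: "X \<in> rsurj UNIV"
  shows "preserves C UNIV (\<lambda>f. f \<circ> X)"
proof -
  have surj: "\<exists>m. X m = i" for i using X by (auto simp: rsurj_def surj_def) metis
  have sq: "sq_le (f \<circ> X) (g \<circ> X) \<longleftrightarrow> sq_le f g" for f g
    unfolding sq_le_def comp_apply using surj by metis
  have eq: "f \<circ> X = g \<circ> X \<longleftrightarrow> f = g" for f g :: cantor
    unfolding fun_eq_iff comp_apply using surj by metis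
  have adj: "adj (f \<circ> X) (g \<circ> X) \<longleftrightarrow> adj f g" for f g
    unfolding adj_def eq unfolding comp_apply using surj by metis
  show ?thesis
    using C unfolding preserves_def struct_Q_def struct_EQ_def struct_G_def struct_OG_def
      struct_B_def struct_EB_def struct_L_def struct_EL_def rel2_def op0_def op1_def op2_def
    by (auto simp: sq adj lex_le_comp[OF X] meet_def join_def compl_def fun_eq_iff)
qed

lemma embedding_map_comp_rsurj:
  assumes "X \<in> rsurj UNIV"
  shows "embedding_map cantor_topology cantor_topology (\<lambda>f. f \<circ> X)"
proof -
  have "continuous_on UNIV (\<lambda>f :: cantor. f \<circ> X)"
    by (rule continuous_on_coordinatewise_then_product) simp
  then have cont: "continuous_map cantor_topology cantor_topology (\<lambda>f. f \<circ> X)"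
    by (simp add: cantor_topology_eq_euclidean)
  have "compact_space cantor_topology" "Hausdorff_space cantor_topology"
    by (simp_all add: cantor_topology_def compact_space_product_topology compact_space_discrete_topology
        Hausdorff_space_product_topology Hausdorff_space_discrete_topology)
  then have "closed_map cantor_topology cantor_topology (\<lambda>f. f \<circ> X)"
    using continuous_imp_closed_map[OF cont] by blast
  moreover have "inj (\<lambda>f :: cantor. f \<circ> X)"
    using assms by (intro injI) (metis (mono_tags, lifting) mem_Collect_eq rsurj_def surj_fun_eq)
  ultimately show ?thesis
    using cont by (intro injective_closed_imp_embedding_map) (auto simp: inj_on_def)
qed

theorem theorem4p3:
  fixes C :: "cantor fo_structure" and A :: "cantor set"
  assumes "C \<in> {struct_Q, struct_EQ, struct_G, struct_OG,
                struct_B, struct_EB, struct_L, struct_EL}"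
    and "is_substructure C A" and "finite A"
  shows "\<exists>t::nat. t \<ge> 1 \<and>
    (\<forall>k::nat. k \<ge> 1 \<longrightarrow>
      (\<forall>\<gamma>. borel_coloring (Emb_topology (induced C A) C) k \<gamma> \<longrightarrow>
        (\<exists>g. topological_fo_embedding C g \<and>
             card (\<gamma> ` (compose A g ` Emb (induced C A) C)) \<le> t) \<and>
        (\<exists>K. topological_copy C K \<and>
             card (\<gamma> ` Emb (induced C A) (induced C K)) \<le> t)))"
proof -
  have car: "carrier C = UNIV"
    using assms(1) by (auto simp: struct_Q_def struct_EQ_def struct_G_def struct_OG_def
        struct_B_def struct_EB_def struct_L_def struct_EL_def)
  then have ind: "induced C UNIV = C" using induced_carrier[of C] by simp
  have closed: "closed_under_ops C A" using assms(2) by (simp add: is_substructure_def)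
  have closedU: "closed_under_ops C UNIV" by (simp add: closed_under_ops_def)
  have Emb: "Emb (induced C A) (induced C K) = {\<phi> \<in> A \<rightarrow>\<^sub>E K. inj_on \<phi> A \<and> preserves C A \<phi>}" for K
    by (rule Emb_induced[OF closed]) (simp add: car)
  note EmbU = Emb[of UNIV, unfolded ind]
  \<comment> \<open>Chosen before k and the coloring: the bound t is
    \<open>card \<Sigma>\<close>.\<close>
  define \<Sigma> where "\<Sigma> = {\<sigma> :: (cantor \<Rightarrow> bool) list. set \<sigma> \<subseteq> A \<rightarrow>\<^sub>E UNIV \<and> distinct \<sigma>}"
  have fin: "finite \<Sigma>" unfolding \<Sigma>_def using assms(3) by (intro finite_subset_distinct finite_PiE) auto
  have "[] \<in> \<Sigma>" by (simp add: \<Sigma>_def)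
  then have t1: "1 \<le> card \<Sigma>" using fin by (metis One_nat_def Suc_leI card_gt_0_iff empty_iff)
  have "(\<exists>g. topological_fo_embedding C g \<and> card (\<gamma> ` (compose A g ` Emb (induced C A) C)) \<le> card \<Sigma>) \<and>
        (\<exists>K. topological_copy C K \<and> card (\<gamma> ` Emb (induced C A) (induced C K)) \<le> card \<Sigma>)"
    if \<gamma>: "borel_coloring (Emb_topology (induced C A) C) k \<gamma>" for k \<gamma>
  proof -
    have "\<exists>c. \<forall>\<sigma>. (\<forall>j. c \<sigma> -` {j} \<in> sets borel) \<and> (\<forall>x. c \<sigma> x < Suc k) \<and>
      (\<forall>x. word_map A \<sigma> x \<in> Emb (induced C A) C \<longrightarrow> c \<sigma> x = \<gamma> (word_map A \<sigma> x))"
      by (intro choice allI borel_coloring_word_map[OF \<gamma>])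
    then obtain c where c0: "\<forall>\<sigma>. (\<forall>j. c \<sigma> -` {j} \<in> sets borel) \<and> (\<forall>x. c \<sigma> x < Suc k) \<and>
      (\<forall>x. word_map A \<sigma> x \<in> Emb (induced C A) C \<longrightarrow> c \<sigma> x = \<gamma> (word_map A \<sigma> x))" ..
    then have c: "c \<sigma> -` {j} \<in> sets borel" "c \<sigma> x < Suc k"
      "word_map A \<sigma> x \<in> Emb (induced C A) C \<Longrightarrow> c \<sigma> x = \<gamma> (word_map A \<sigma> x)" for \<sigma> j x
      by blast+
    \<comment> \<open>A list of r letters belongs to surjections onto {0, ..., r - 1}. The empty
      list has no surjection and is excluded where the colors are counted.\<close>
    obtain X where X: "X \<in> rsurj UNIV"
      "\<forall>\<sigma>\<in>\<Sigma>. \<exists>j. \<forall>x\<in>rsurj {..length \<sigma> - 1}. c \<sigma> (x \<circ> X) = j"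
      using dual_Ramsey_finitely_many[where c = c and b = "\<lambda>_. Suc k" and n = "\<lambda>\<sigma>. length \<sigma> - 1",
          OF fin c(1,2)] by blast
    obtain J where J: "\<forall>\<sigma>\<in>\<Sigma>. \<forall>x\<in>rsurj {..length \<sigma> - 1}. c \<sigma> (x \<circ> X) = J \<sigma>"
      using bchoice[OF X(2)] by blast
    define g where "g = (\<lambda>f :: cantor. f \<circ> X)"
    have pres: "preserves C UNIV g" unfolding g_def by (rule preserves_comp_rsurj[OF assms(1) X(1)])
    have inj: "inj g" unfolding g_def
      using X(1) by (intro injI) (metis (mono_tags, lifting) mem_Collect_eq rsurj_def surj_fun_eq)
    have g: "topological_fo_embedding C g"
      using fo_embedding_induced_iff[OF closedU, of UNIV g] inj pres embedding_map_comp_rsurj[OF X(1)]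
      by (simp add: topological_fo_embedding_def ind car g_def)
    \<comment> \<open>\<open>c \<sigma>\<close> agrees with the given coloring only on embeddings,
      so the composite must be known to be one.\<close>
    have comp_Emb: "compose A g e \<in> Emb (induced C A) C" if e: "e \<in> Emb (induced C A) C" for e
    proof -
      have "preserves C A (compose A g e) \<longleftrightarrow> preserves C A (g \<circ> e)"
        by (rule preserves_cong[OF _ closed]) (simp add: compose_def)
      then have "preserves C A (compose A g e)" using preserves_comp[OF _ pres] e by (simp add: EmbU)
      moreover have "inj_on (compose A g e) A"
        using e inj by (auto simp: EmbU inj_on_def compose_def)
      ultimately show ?thesis by (auto simp: EmbU compose_def)
    qed
    have colors: "\<gamma> ` (compose A g ` Emb (induced C A) C) \<subseteq> J ` \<Sigma>"
    proof clarify
      fix e assume e: "e \<in> Emb (induced C A) C"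
      then obtain \<sigma> x where \<sigma>: "distinct \<sigma>" "set \<sigma> \<subseteq> A \<rightarrow>\<^sub>E UNIV" "x \<in> rsurj {..<length \<sigma>}" "e = word_map A \<sigma> x"
        using word_map_exists[OF assms(3), of e] by (auto simp: EmbU PiE_def)
      have "\<sigma> \<in> \<Sigma>" using \<sigma> by (simp add: \<Sigma>_def)
      have "\<sigma> \<noteq> []" using \<sigma>(3) by (auto simp: rsurj_def)
      then have "{..<length \<sigma>} = {..length \<sigma> - 1}" by (cases \<sigma>) (auto simp: lessThan_Suc_atMost)
      then have "c \<sigma> (x \<circ> X) = J \<sigma>" using J \<open>\<sigma> \<in> \<Sigma>\<close> \<sigma>(3) by metis
      moreover have "compose A g e = word_map A \<sigma> (x \<circ> X)"
        unfolding \<sigma>(4) g_def by (rule compose_word_map)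
      moreover have "word_map A \<sigma> (x \<circ> X) \<in> Emb (induced C A) C" using comp_Emb[OF e] calculation(2) by simp
      ultimately have "\<gamma> (compose A g e) = J \<sigma>" using c(3) by simp
      then show "\<gamma> (compose A g e) \<in> J ` \<Sigma>" using \<open>\<sigma> \<in> \<Sigma>\<close> by blast
    qed
    have bound: "card B \<le> card \<Sigma>" if "B \<subseteq> J ` \<Sigma>" for B
      using that fin by (meson card_image_le card_mono finite_imageI le_trans)
    \<comment> \<open>Every embedding into the copy factors through g, so the bound for the
      composites also covers the copy.\<close>
    have "Emb (induced C A) (induced C (range g)) \<subseteq> compose A g ` Emb (induced C A) C"
    proof
      fix e assume e: "e \<in> Emb (induced C A) (induced C (range g))"
      define e' where "e' = (\<lambda>a\<in>A. inv g (e a))"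
      have ge': "g (e' a) = e a" if "a \<in> A" for a
      proof -
        have "e a \<in> range g" using that e by (auto simp: Emb)
        then show ?thesis using that by (simp add: e'_def f_inv_into_f)
      qed
      have "preserves C A (g \<circ> e') \<longleftrightarrow> preserves C A e"
        by (rule preserves_cong[OF _ closed]) (simp add: ge')
      then have "preserves C A e'" using preserves_cancel[OF _ pres inj] e by (simp add: Emb)
      moreover have "inj_on e' A" using e ge' by (auto simp: Emb inj_on_def) metis
      ultimately have "e' \<in> Emb (induced C A) C" by (auto simp: EmbU e'_def)
      moreover have "compose A g e' = e"
      proof
        show "compose A g e' a = e a" for a
          using e ge' by (cases "a \<in> A") (auto simp: compose_def Emb PiE_iff extensional_def)
      qed
      ultimately show "e \<in> compose A g ` Emb (induced C A) C" by blast
    qed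
    then have "card (\<gamma> ` Emb (induced C A) (induced C (range g))) \<le> card \<Sigma>"
      using colors by (intro bound) blast
    moreover have "topological_copy C (range g)"
      using g by (auto simp: topological_copy_def car)
    ultimately show ?thesis using g bound[OF colors] by blast
  qed
  then show ?thesis using t1 by blast
qed

end
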